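(* Fix $p>0$ and let $m=\max(4,3p)$. Let $X$ be a real random variable with $0<\mathbb{E}|X|^{m}<\infty$, and for each $d\ge 1$ let $\mathbf{X}=(X_1,\dots,X_d)$ be a random vector whose components are i.i.d. copies of $X$. Then, as $d\to\infty$, $$\mathbb{E}\Vert\mathbf{X}\Vert_p=d^{1/p}\mu_p^{1/p}+O(d^{1/p-1})$$ and $$\operatorname{Var}\Vert\mathbf{X}\Vert_p=\frac{\mu_p^{2/p-2}\sigma_p^2}{d^{1-2/p}p^2}+o(d^{-1+2/p}),$$ which implies $$\frac{\sqrt{d\,\operatorname{Var}\Vert\mathbf{X}\Vert_p}}{\mathbb{E}\Vert\mathbf{X}\Vert_p}\to\frac{\sigma_p}{p\mu_p},\quad\text{as } d\to\infty.$$
   Context: For $\mathbf{x}=(x_1,\dots,x_d)\in\mathbb{R}^d$ and $0<p<\infty$, $\Vert\mathbf{x}\Vert_p=\left(\sum_{j=1}^d|x_j|^p\right)^{1/p}$ (for all $p>0$, even when $p<1$ and this is not a norm). Notation: $\mu_p=\mathbb{E}|X|^p$, $\sigma_p^2=\operatorname{Var}|X|^p$, $\sigma_p\ge 0$. *)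

theory Defs
  imports "HOL-Probability.Probability" "HOL-Library.Landau_Symbols"
begin

text \<open>A vector in dimension \<open>d\<close> is a function on \<open>{1..d}\<close>, so that \<open>d\<close> can tend to infinity.
  Since \<open>0 powr p = 0\<close>, vanishing coordinates contribute nothing to the sum.\<close>

definition lp_norm :: "real \<Rightarrow> nat \<Rightarrow> (nat \<Rightarrow> real) \<Rightarrow> real" where
  "lp_norm p d x = (\<Sum>j = 1..d. \<bar>x j\<bar> powr p) powr (1 / p)"

definition abs_moment :: "'a measure \<Rightarrow> ('a \<Rightarrow> real) \<Rightarrow> real \<Rightarrow> real" where
  "abs_moment M X p = prob_space.expectation M (\<lambda>\<omega>. \<bar>X \<omega>\<bar> powr p)"

definition abs_pow_sd :: "'a measure \<Rightarrow> ('a \<Rightarrow> real) \<Rightarrow> real \<Rightarrow> real" where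
  "abs_pow_sd M X p = sqrt (prob_space.variance M (\<lambda>\<omega>. \<bar>X \<omega>\<bar> powr p))"

definition iid_copies ::
  "'b measure \<Rightarrow> (nat \<Rightarrow> 'b \<Rightarrow> real) \<Rightarrow> nat \<Rightarrow> 'a measure \<Rightarrow> ('a \<Rightarrow> real) \<Rightarrow> bool" where
  "iid_copies N Y d M X \<longleftrightarrow>
     prob_space.indep_vars N (\<lambda>_. borel) Y {1..d} \<and>
     (\<forall>j\<in>{1..d}. distr N borel (Y j) = distr M borel X)"

end

theory Submission
  imports Defs "HOL-Real_Asymp.Real_Asymp"
begin

text \<open>Let \<open>Z\<^sub>j = \<bar>X\<^sub>j\<bar> powr p\<close>, \<open>a = 1 / p\<close> and \<open>r = m / p = max 3 (4 * a)\<close>. With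
  \<open>t = (\<Sum>j\<le>d. (Z\<^sub>j - \<mu>)) / (d * \<mu>)\<close> the norm is \<open>(d * \<mu>) powr a * h\<close> for \<open>h = \<bar>1 + t\<bar> powr a\<close>.
  Pointwise, \<open>h - 1\<close> differs from \<open>a * t\<close> by \<open>O(t\<^sup>2 + \<bar>t\<bar> powr r)\<close>, and \<open>(h - 1)\<^sup>2\<close> differs from
  \<open>a\<^sup>2 * t\<^sup>2\<close> by \<open>O(\<bar>t\<bar> powr 3 + \<bar>t\<bar> powr r)\<close>. As the \<open>s\<close>-th absolute moment of a sum of \<open>d\<close>
  centered independent variables is \<open>O(d powr (s / 2))\<close> for \<open>s > 2\<close>, the expected errors are
  \<open>O(1 / d)\<close> and \<open>O(d powr (-3/2))\<close>, while \<open>E t\<^sup>2 = Var \<bar>X\<bar>\<^sup>p / (d * \<mu>\<^sup>2)\<close>.\<close>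

section \<open>Pointwise bounds for real powers of absolute values\<close>

text \<open>For small \<open>t\<close> this is Taylor's formula with a second-order remainder; for
  large \<open>t\<close> each of the three terms on the left is dominated separately, since
  \<open>q\<close> is at least both \<open>a\<close> and 1. The regimes stay apart in a case
  distinction because \<open>q < 2\<close> is possible: a sum of both error terms would then be too
  large near 0 for the second-order estimate derived from it.\<close>

lemma abs_one_plus_powr_linearization:
  fixes a q :: real
  assumes "a > 0" "q \<ge> a" "q \<ge> 1"
  obtains C where "C \<ge> 1"
    and "\<And>t. \<bar>\<bar>1 + t\<bar> powr a - 1 - a * t\<bar> \<le> C * (if \<bar>t\<bar> \<le> 1/2 then t\<^sup>2 else \<bar>t\<bar> powr q)"
proof -
  define C1 where "C1 = \<bar>a * (a - 1)\<bar> * 2 powr \<bar>a - 2\<bar>"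
  define C2 where "C2 = (2 powr a + 1 + a) * 2 powr q"
  have C1: "C1 \<ge> 0" by (simp add: C1_def)
  have "2 powr q \<ge> 1" "2 powr a + 1 + a \<ge> 1"
    using assms by (auto simp: ge_one_powr_ge_zero)
  then have C2: "C2 \<ge> 1"
    unfolding C2_def using mult_mono[of 1 "2 powr a + 1 + a" 1 "2 powr q"] by simp
  have near: "\<bar>\<bar>1 + t\<bar> powr a - 1 - a * t\<bar> \<le> C1 * t\<^sup>2" if t: "\<bar>t\<bar> \<le> 1/2" for t
  proof (cases "t = 0")
    case False
    \<comment> \<open>Entries 0, 1 and 2 are the successive derivatives of
      \<open>(1 + z) powr a\<close>. An expansion of order 2 reads no further entry, so all later
      ones may repeat the second derivative.\<close>
    define diff where "diff = (\<lambda>m::nat. if m = 0 then (\<lambda>z. (1 + z) powr a)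
      else if m = 1 then (\<lambda>z. a * (1 + z) powr (a - 1))
      else (\<lambda>z. a * ((a - 1) * (1 + z) powr (a - 2))))"
    have "\<exists>\<xi>. (if t < 0 then t < \<xi> \<and> \<xi> < 0 else 0 < \<xi> \<and> \<xi> < t) \<and>
        (1 + t) powr a = (\<Sum>m<2. diff m 0 / fact m * (t - 0) ^ m) + diff 2 \<xi> / fact 2 * (t - 0)\<^sup>2"
    \<comment> \<open>On this interval \<open>1 + z\<close> stays away from the singularity of the
      power at 0.\<close>
    proof (rule Taylor[where a = "-1/2" and b = "1/2" and diff = diff])
      show "\<forall>m z. m < 2 \<and> - 1 / 2 \<le> z \<and> z \<le> 1 / 2 \<longrightarrow> DERIV (diff m) z :> diff (Suc m) z"
        by (auto simp: diff_def less_2_cases_iff intro!: derivative_eq_intros)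
    qed (use t False in \<open>auto simp: diff_def\<close>)
    then obtain \<xi> where \<xi>: "if t < 0 then t < \<xi> \<and> \<xi> < 0 else 0 < \<xi> \<and> \<xi> < t"
      and eq: "(1 + t) powr a = 1 + a * t + a * (a - 1) * (1 + \<xi>) powr (a - 2) / 2 * t\<^sup>2"
      by (auto simp: diff_def lessThan_Suc numeral_2_eq_2 algebra_simps)
    \<comment> \<open>With the base between 1/2 and 2, the power is at most
      \<open>2 powr |a - 2|\<close> whatever the sign of \<open>a - 2\<close>.\<close>
    have \<xi>': "1/2 \<le> 1 + \<xi>" "1 + \<xi> \<le> 2" using \<xi> t by (auto split: if_splits)
    have "(1 + \<xi>) powr (a - 2) \<le> 2 powr \<bar>a - 2\<bar>"
    proof (cases "a \<ge> 2")
      case True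
      then show ?thesis using \<xi>' by (auto intro!: powr_mono2)
    next
      case False
      then have "(1 + \<xi>) powr (a - 2) \<le> (1/2) powr (a - 2)"
        using \<xi>' by (intro powr_mono2') auto
      also have "\<dots> = 2 powr \<bar>a - 2\<bar>" using False by (simp add: powr_divide powr_minus_divide[symmetric])
      finally show ?thesis .
    qed
    then have "\<bar>a * (a - 1)\<bar> * ((1 + \<xi>) powr (a - 2) / 2) \<le> \<bar>a * (a - 1)\<bar> * 2 powr \<bar>a - 2\<bar>"
      using powr_ge_zero[of 2 "\<bar>a - 2\<bar>"] by (intro mult_left_mono) linarith+
    then have "\<bar>a * (a - 1) * (1 + \<xi>) powr (a - 2) / 2 * t\<^sup>2\<bar> \<le> C1 * t\<^sup>2"
      unfolding C1_def using mult_right_mono[of _ _ "t\<^sup>2"] by (fastforce simp: abs_mult mult_ac)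
    moreover have "\<bar>1 + t\<bar> = 1 + t" using t by auto
    ultimately show ?thesis using eq by simp
  qed simp
  have far: "\<bar>\<bar>1 + t\<bar> powr a - 1 - a * t\<bar> \<le> C2 * \<bar>t\<bar> powr q" if t: "\<not> \<bar>t\<bar> \<le> 1/2" for t
  proof -
    \<comment> \<open>Doubling makes the base at least 1, so that its powers increase with the
      exponent; the price is the factor \<open>2 powr q\<close> in \<open>C2\<close>. Moreover
      \<open>|1 + t| <= 1 + |t| <= 2 * ?u\<close>.\<close>
    let ?u = "2 * \<bar>t\<bar>"
    have u: "1 \<le> ?u" using t by auto
    have "\<bar>1 + t\<bar> powr a \<le> (2 * ?u) powr a"
      using assms t by (intro powr_mono2) auto
    also have "\<dots> = 2 powr a * ?u powr a" by (rule powr_mult)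
    also have "\<dots> \<le> 2 powr a * ?u powr q" using u assms by (intro mult_left_mono powr_mono) auto
    finally have 1: "\<bar>1 + t\<bar> powr a \<le> 2 powr a * ?u powr q" .
    have 2: "1 \<le> ?u powr q" using u assms by (intro ge_one_powr_ge_zero) auto
    have "\<bar>t\<bar> \<le> ?u powr 1" by simp
    also have "\<dots> \<le> ?u powr q" using u assms by (intro powr_mono) auto
    finally have 3: "\<bar>a * t\<bar> \<le> a * ?u powr q"
      using assms by (auto simp: abs_mult intro!: mult_left_mono)
    have "\<bar>\<bar>1 + t\<bar> powr a - 1 - a * t\<bar> \<le> \<bar>1 + t\<bar> powr a + 1 + \<bar>a * t\<bar>"
      by (smt (verit) powr_ge_zero)
    also have "\<dots> \<le> (2 powr a + 1 + a) * ?u powr q" using 1 2 3 by (simp add: algebra_simps)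
    also have "\<dots> = C2 * \<bar>t\<bar> powr q" by (simp add: C2_def powr_mult)
    finally show ?thesis .
  qed
  show thesis
  proof (rule that)
    show "max C1 C2 \<ge> 1" using C2 by simp
    show "\<bar>\<bar>1 + t\<bar> powr a - 1 - a * t\<bar> \<le> max C1 C2 * (if \<bar>t\<bar> \<le> 1/2 then t\<^sup>2 else \<bar>t\<bar> powr q)" for t
      using near[of t] far[of t] mult_right_mono[of C1 "max C1 C2" "t\<^sup>2"]
        mult_right_mono[of C2 "max C1 C2" "\<bar>t\<bar> powr q"]
      by (smt (verit) max.cobounded1 max.cobounded2 powr_ge_zero zero_le_power2)
  qed
qed

text \<open>Both regimes are dominated by the sum of the two error terms, which can be integrated
  without splitting the domain.\<close>

lemma abs_one_plus_powr_first_order: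
  fixes a r :: real
  assumes "a > 0" "r \<ge> a" "r \<ge> 1"
  obtains C where "C \<ge> 1"
    and "\<And>t. \<bar>\<bar>1 + t\<bar> powr a - 1 - a * t\<bar> \<le> C * (t\<^sup>2 + \<bar>t\<bar> powr r)"
proof -
  obtain C where C: "C \<ge> 1"
    "\<And>t. \<bar>\<bar>1 + t\<bar> powr a - 1 - a * t\<bar> \<le> C * (if \<bar>t\<bar> \<le> 1/2 then t\<^sup>2 else \<bar>t\<bar> powr r)"
    using abs_one_plus_powr_linearization[OF assms] by metis
  have "\<bar>\<bar>1 + t\<bar> powr a - 1 - a * t\<bar> \<le> C * (t\<^sup>2 + \<bar>t\<bar> powr r)" for t
    using C(1) by (intro order_trans[OF C(2)] mult_left_mono) auto
  then show thesis using that C by blast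
qed

text \<open>With \<open>\<rho>\<close> the error of the linearization, the difference is
  \<open>2 * a * t * \<rho> + \<rho>^2\<close>. Taking the exponent \<open>r/2\<close> in the
  linearization makes \<open>\<rho>^2\<close> of order \<open>|t| powr r\<close> for large
  \<open>t\<close>; for small \<open>t\<close> the cross term is cubic and \<open>\<rho>^2\<close>
  is of order \<open>t^4\<close>.\<close>

lemma abs_one_plus_powr_second_order:
  fixes a r :: real
  assumes "a > 0" "r \<ge> 2 * a" "r \<ge> 2"
  obtains C where "C \<ge> 1"
    and "\<And>t. \<bar>(\<bar>1 + t\<bar> powr a - 1)\<^sup>2 - a\<^sup>2 * t\<^sup>2\<bar> \<le> C * (\<bar>t\<bar> powr 3 + \<bar>t\<bar> powr r)"
proof -
  obtain C where C: "C \<ge> 1"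
    "\<And>t. \<bar>\<bar>1 + t\<bar> powr a - 1 - a * t\<bar> \<le> C * (if \<bar>t\<bar> \<le> 1/2 then t\<^sup>2 else \<bar>t\<bar> powr (r/2))"
    using abs_one_plus_powr_linearization[of a "r/2"] assms by auto
  \<comment> \<open>The sum of the coefficients of the cross term and of the squared error.\<close>
  define D where "D = 2 * a * C + C\<^sup>2"
  have D: "D \<ge> 1" using C(1) assms power_mono[of 1 C 2] by (simp add: D_def add_increasing)
  have bd: "\<bar>(\<bar>1 + t\<bar> powr a - 1)\<^sup>2 - a\<^sup>2 * t\<^sup>2\<bar> \<le> 2 * a * C * (\<bar>t\<bar> * v) + C\<^sup>2 * v\<^sup>2"
    if v: "\<bar>\<bar>1 + t\<bar> powr a - 1 - a * t\<bar> \<le> C * v" for t v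
  proof -
    define \<rho> where "\<rho> = \<bar>1 + t\<bar> powr a - 1 - a * t"
    have "(\<bar>1 + t\<bar> powr a - 1)\<^sup>2 - a\<^sup>2 * t\<^sup>2 = 2 * a * (t * \<rho>) + \<rho>\<^sup>2"
      unfolding \<rho>_def by algebra
    also have "\<bar>\<dots>\<bar> \<le> 2 * a * (\<bar>t\<bar> * \<bar>\<rho>\<bar>) + \<bar>\<rho>\<bar>\<^sup>2"
      using assms by (intro order_trans[OF abs_triangle_ineq]) (auto simp: abs_mult)
    also have "\<dots> \<le> 2 * a * (\<bar>t\<bar> * (C * v)) + (C * v)\<^sup>2"
      using v assms by (intro add_mono mult_left_mono power_mono) (auto simp: \<rho>_def)
    finally show ?thesis by (simp add: power_mult_distrib algebra_simps)
  qed
  have near: "\<bar>(\<bar>1 + t\<bar> powr a - 1)\<^sup>2 - a\<^sup>2 * t\<^sup>2\<bar> \<le> D * \<bar>t\<bar> powr 3" if t: "\<bar>t\<bar> \<le> 1/2" for t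
  proof -
    have "\<bar>(\<bar>1 + t\<bar> powr a - 1)\<^sup>2 - a\<^sup>2 * t\<^sup>2\<bar> \<le> 2 * a * C * (\<bar>t\<bar> * t\<^sup>2) + C\<^sup>2 * (t\<^sup>2)\<^sup>2"
      using C(2)[of t] t by (intro bd) auto
    also have "(t\<^sup>2)\<^sup>2 = \<bar>t\<bar> * \<bar>t\<bar> ^ 3"
      by (simp add: power2_eq_square power3_eq_cube)
    also have "\<bar>t\<bar> * t\<^sup>2 = \<bar>t\<bar> ^ 3"
      by (simp add: power2_eq_square power3_eq_cube)
    \<comment> \<open>One factor \<open>|t|\<close> of the quartic term is replaced by 1, so that
      only cubes remain.\<close>
    also have "2 * a * C * \<bar>t\<bar> ^ 3 + C\<^sup>2 * (\<bar>t\<bar> * \<bar>t\<bar> ^ 3) \<le> 2 * a * C * \<bar>t\<bar> ^ 3 + C\<^sup>2 * (1 * \<bar>t\<bar> ^ 3)"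
      using t assms C(1) by (intro add_mono mult_left_mono mult_right_mono) auto
    also have "\<dots> = D * \<bar>t\<bar> powr 3" by (simp add: D_def algebra_simps)
    finally show ?thesis .
  qed
  have far: "\<bar>(\<bar>1 + t\<bar> powr a - 1)\<^sup>2 - a\<^sup>2 * t\<^sup>2\<bar> \<le> (D * 2 powr r) * \<bar>t\<bar> powr r" if t: "\<not> \<bar>t\<bar> \<le> 1/2" for t
  proof -
    let ?u = "2 * \<bar>t\<bar>"
    have u: "1 \<le> ?u" using t by auto
    have *: "\<bar>t\<bar> powr (r/2) \<le> ?u powr (r/2)" using assms by (intro powr_mono2) auto
    \<comment> \<open>The cross term has exponent \<open>1 + r/2\<close>, which is at most
      \<open>r\<close> because \<open>r >= 2\<close>.\<close>
    have le: "\<bar>t\<bar> * \<bar>t\<bar> powr (r/2) \<le> ?u powr r"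
    proof -
      have "\<bar>t\<bar> * \<bar>t\<bar> powr (r/2) \<le> ?u powr 1 * ?u powr (r/2)"
        using * by (intro mult_mono) auto
      also have "\<dots> = ?u powr (1 + r/2)" by (simp only: powr_add)
      also have "\<dots> \<le> ?u powr r" using u assms by (intro powr_mono) auto
      finally show ?thesis .
    qed
    have sq: "(\<bar>t\<bar> powr (r/2))\<^sup>2 \<le> ?u powr r"
    proof -
      have "(\<bar>t\<bar> powr (r/2))\<^sup>2 \<le> (?u powr (r/2))\<^sup>2" using * by (intro power_mono) auto
      also have "\<dots> = ?u powr r" by (simp only: power2_eq_square powr_add[symmetric]) simp
      finally show ?thesis .
    qed
    have "\<bar>(\<bar>1 + t\<bar> powr a - 1)\<^sup>2 - a\<^sup>2 * t\<^sup>2\<bar>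
        \<le> 2 * a * C * (\<bar>t\<bar> * \<bar>t\<bar> powr (r/2)) + C\<^sup>2 * (\<bar>t\<bar> powr (r/2))\<^sup>2"
      using C(2)[of t] t by (intro bd) auto
    also have "\<dots> \<le> 2 * a * C * ?u powr r + C\<^sup>2 * ?u powr r"
      using le sq assms C(1) by (intro add_mono mult_left_mono) auto
    also have "\<dots> = (D * 2 powr r) * \<bar>t\<bar> powr r" by (simp add: D_def powr_mult algebra_simps)
    finally show ?thesis .
  qed
  have D': "D \<le> D * 2 powr r" "1 \<le> D * 2 powr r"
    using D assms ge_one_powr_ge_zero[of 2 r] mult_mono[of 1 D 1 "2 powr r"] by auto
  show thesis
  proof (rule that[OF D'(2)])
    show "\<bar>(\<bar>1 + t\<bar> powr a - 1)\<^sup>2 - a\<^sup>2 * t\<^sup>2\<bar> \<le> D * 2 powr r * (\<bar>t\<bar> powr 3 + \<bar>t\<bar> powr r)" for t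
    proof (cases "\<bar>t\<bar> \<le> 1/2")
      case True
      have "D * \<bar>t\<bar> powr 3 \<le> D * 2 powr r * (\<bar>t\<bar> powr 3 + \<bar>t\<bar> powr r)"
        using D D' by (intro mult_mono) auto
      with near[OF True] show ?thesis by linarith
    next
      case False
      have "D * 2 powr r * \<bar>t\<bar> powr r \<le> D * 2 powr r * (\<bar>t\<bar> powr 3 + \<bar>t\<bar> powr r)"
        using D' by (intro mult_left_mono) auto
      with far[OF False] show ?thesis by linarith
    qed
  qed
qed

text \<open>The first-order bound with \<open>a = r\<close>, applied to \<open>t = w / x\<close> and
  multiplied by \<open>|x| powr r\<close>. The linear term is kept exactly, so that it disappears in
  expectation when \<open>w\<close> is replaced by a centered variable independent of the one
  replacing \<open>x\<close>.\<close>

lemma abs_add_powr_le: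
  fixes r :: real
  assumes "r > 1"
  obtains C where "C \<ge> 1"
    and "\<And>x w. \<bar>x + w\<bar> powr r \<le> \<bar>x\<bar> powr r + r * ((sgn x * \<bar>x\<bar> powr (r - 1)) * w)
            + C * (\<bar>x\<bar> powr (r - 2) * w\<^sup>2 + \<bar>w\<bar> powr r)"
proof -
  obtain C where C: "C \<ge> 1"
    "\<And>t. \<bar>\<bar>1 + t\<bar> powr r - 1 - r * t\<bar> \<le> C * (t\<^sup>2 + \<bar>t\<bar> powr r)"
    using abs_one_plus_powr_first_order[of r r] assms by auto
  have "\<bar>x + w\<bar> powr r \<le> \<bar>x\<bar> powr r + r * ((sgn x * \<bar>x\<bar> powr (r - 1)) * w)
            + C * (\<bar>x\<bar> powr (r - 2) * w\<^sup>2 + \<bar>w\<bar> powr r)" for x w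
  proof (cases "x = 0")
    \<comment> \<open>At \<open>x = 0\<close> every power of \<open>|x|\<close> is 0, and
      \<open>C >= 1\<close> covers the remaining \<open>|w| powr r\<close>.\<close>
    case True
    then show ?thesis using C(1) mult_right_mono[of 1 C "\<bar>w\<bar> powr r"] by simp
  next
    case False
    define t where "t = w / x"
    have w: "w = x * t" using False by (simp add: t_def)
    have e1: "\<bar>x + w\<bar> powr r = \<bar>x\<bar> powr r * \<bar>1 + t\<bar> powr r"
      by (simp add: w powr_mult[symmetric] abs_mult[symmetric] algebra_simps)
    have "\<bar>x\<bar> powr r = \<bar>x\<bar> powr 1 * \<bar>x\<bar> powr (r - 1)" by (subst powr_add[symmetric]) simp
    then have e2: "(sgn x * \<bar>x\<bar> powr (r - 1)) * w = \<bar>x\<bar> powr r * t"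
      using False by (simp add: w sgn_if)
    have "\<bar>x\<bar> powr r = \<bar>x\<bar> powr 2 * \<bar>x\<bar> powr (r - 2)" by (subst powr_add[symmetric]) simp
    then have e3: "\<bar>x\<bar> powr (r - 2) * w\<^sup>2 = \<bar>x\<bar> powr r * t\<^sup>2"
      using False by (simp add: w power_mult_distrib)
    have e4: "\<bar>w\<bar> powr r = \<bar>x\<bar> powr r * \<bar>t\<bar> powr r"
      by (simp add: w powr_mult abs_mult)
    have "\<bar>1 + t\<bar> powr r \<le> 1 + r * t + C * (t\<^sup>2 + \<bar>t\<bar> powr r)"
      using C(2)[of t] by linarith
    then have "\<bar>x\<bar> powr r * \<bar>1 + t\<bar> powr r \<le> \<bar>x\<bar> powr r * (1 + r * t + C * (t\<^sup>2 + \<bar>t\<bar> powr r))"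
      by (intro mult_left_mono) auto
    then show ?thesis unfolding e1 e2 e3 e4 by (simp add: algebra_simps)
  qed
  then show thesis using that C(1) by blast
qed

lemma powr_le_one_plus_powr:
  fixes x s r :: real
  assumes "x \<ge> 0" "0 \<le> s" "s \<le> r"
  shows "x powr s \<le> 1 + x powr r"
proof (cases "x \<le> 1")
  case True
  then have "x powr s \<le> 1 powr s" using assms by (intro powr_mono2) auto
  then show ?thesis by (simp add: add_increasing2)
next
  case False
  then have "x powr s \<le> x powr r" using assms by (intro powr_mono) auto
  then show ?thesis by simp
qed

lemma abs_add_powr_le_sum:
  fixes x w r :: real
  assumes "r \<ge> 0"
  shows "\<bar>x + w\<bar> powr r \<le> 2 powr r * (\<bar>x\<bar> powr r + \<bar>w\<bar> powr r)"
proof -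
  have "\<bar>x + w\<bar> powr r \<le> (2 * max \<bar>x\<bar> \<bar>w\<bar>) powr r"
    using assms by (intro powr_mono2) auto
  also have "\<dots> = 2 powr r * max \<bar>x\<bar> \<bar>w\<bar> powr r" by (rule powr_mult)
  also have "\<dots> \<le> 2 powr r * (\<bar>x\<bar> powr r + \<bar>w\<bar> powr r)"
    by (intro mult_left_mono) (auto simp: max_def)
  finally show ?thesis .
qed

section \<open>Integrability and independence\<close>

context prob_space
begin

lemma indep_vars_rv:
  assumes "indep_vars M' X I" "i \<in> I"
  shows "X i \<in> measurable M (M' i)"
  using assms unfolding indep_vars_def by blast

lemma integrable_abs_powr_mono:
  fixes f :: "'a \<Rightarrow> real"
  assumes "integrable M (\<lambda>\<omega>. \<bar>f \<omega>\<bar> powr r)" "f \<in> borel_measurable M" "0 \<le> s" "s \<le> r"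
  shows "integrable M (\<lambda>\<omega>. \<bar>f \<omega>\<bar> powr s)"
proof (rule Bochner_Integration.integrable_bound)
  show "integrable M (\<lambda>\<omega>. 1 + \<bar>f \<omega>\<bar> powr r)" using assms(1) by simp
  show "AE \<omega> in M. norm (\<bar>f \<omega>\<bar> powr s) \<le> norm (1 + \<bar>f \<omega>\<bar> powr r)"
    using powr_le_one_plus_powr[of "\<bar>f _\<bar>" s r] assms(3,4)
    by (auto simp: add_nonneg_nonneg)
qed (use assms in measurable)

lemma integrable_power2_of_abs_powr:
  fixes f :: "'a \<Rightarrow> real"
  assumes "integrable M (\<lambda>\<omega>. \<bar>f \<omega>\<bar> powr r)" "f \<in> borel_measurable M" "2 \<le> r"
  shows "integrable M (\<lambda>\<omega>. (f \<omega>)\<^sup>2)"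
  using integrable_abs_powr_mono[OF assms(1,2), of 2] assms(3) by simp

lemma integrable_of_abs_powr:
  fixes f :: "'a \<Rightarrow> real"
  assumes "integrable M (\<lambda>\<omega>. \<bar>f \<omega>\<bar> powr r)" "f \<in> borel_measurable M" "1 \<le> r"
  shows "integrable M f"
proof -
  have "integrable M (\<lambda>\<omega>. \<bar>f \<omega>\<bar>)"
    using integrable_abs_powr_mono[OF assms(1,2), of 1] assms(3) by simp
  then show ?thesis using assms(2) by (simp add: integrable_abs_iff)
qed

lemma integrable_abs_add_powr:
  fixes U W :: "'a \<Rightarrow> real"
  assumes "integrable M (\<lambda>\<omega>. \<bar>U \<omega>\<bar> powr r)" "integrable M (\<lambda>\<omega>. \<bar>W \<omega>\<bar> powr r)"
    and [measurable]: "U \<in> borel_measurable M" "W \<in> borel_measurable M" and "r \<ge> 0"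
  shows "integrable M (\<lambda>\<omega>. \<bar>U \<omega> + W \<omega>\<bar> powr r)"
proof (rule Bochner_Integration.integrable_bound)
  show "integrable M (\<lambda>\<omega>. 2 powr r * (\<bar>U \<omega>\<bar> powr r + \<bar>W \<omega>\<bar> powr r))" using assms by simp
  show "AE \<omega> in M. norm (\<bar>U \<omega> + W \<omega>\<bar> powr r) \<le> norm (2 powr r * (\<bar>U \<omega>\<bar> powr r + \<bar>W \<omega>\<bar> powr r))"
    using abs_add_powr_le_sum[OF assms(5)] by (auto simp: abs_mult add_nonneg_nonneg)
qed measurable

text \<open>The pair is ordered \<open>W\<close>, \<open>U\<close> because
  \<open>indep_vars_sum\<close> states the independence of a new summand and a partial sum in this
  order.\<close>

lemma indep_var_expectation_mult:
  fixes U W :: "'a \<Rightarrow> real" and f g :: "real \<Rightarrow> real"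
  assumes "indep_var borel W borel U"
    and [measurable]: "f \<in> borel_measurable borel" "g \<in> borel_measurable borel"
    and "integrable M (\<lambda>\<omega>. f (U \<omega>))" "integrable M (\<lambda>\<omega>. g (W \<omega>))"
  shows "integrable M (\<lambda>\<omega>. f (U \<omega>) * g (W \<omega>))"
    and "expectation (\<lambda>\<omega>. f (U \<omega>) * g (W \<omega>)) = expectation (\<lambda>\<omega>. f (U \<omega>)) * expectation (\<lambda>\<omega>. g (W \<omega>))"
proof -
  have "indep_var borel (g \<circ> W) borel (f \<circ> U)"
    by (intro indep_var_compose[OF assms(1)]) auto
  then have ind: "indep_var borel (\<lambda>\<omega>. g (W \<omega>)) borel (\<lambda>\<omega>. f (U \<omega>))" by (simp add: comp_def)
  show "integrable M (\<lambda>\<omega>. f (U \<omega>) * g (W \<omega>))"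
    using indep_var_integrable[OF ind assms(5,4)] by (simp add: mult.commute)
  show "expectation (\<lambda>\<omega>. f (U \<omega>) * g (W \<omega>)) = expectation (\<lambda>\<omega>. f (U \<omega>)) * expectation (\<lambda>\<omega>. g (W \<omega>))"
    using indep_var_lebesgue_integral[OF ind assms(5,4)] by (simp add: mult.commute)
qed

text \<open>The pointwise expansion is integrated: independence factors the mixed terms, and the
  linear one vanishes since \<open>W\<close> is centered. The constant \<open>C\<close> is a
  parameter, so that it can be fixed before any probability space is chosen.\<close>

lemma expectation_abs_add_powr_le:
  fixes U W :: "'a \<Rightarrow> real"
  assumes ind: "indep_var borel W borel U"
    and U: "integrable M (\<lambda>\<omega>. \<bar>U \<omega>\<bar> powr r)" and W: "integrable M (\<lambda>\<omega>. \<bar>W \<omega>\<bar> powr r)"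
    and W0: "expectation W = 0" and r: "r \<ge> 2"
    and C: "\<And>x w. \<bar>x + w\<bar> powr r \<le> \<bar>x\<bar> powr r + r * ((sgn x * \<bar>x\<bar> powr (r - 1)) * w)
            + C * (\<bar>x\<bar> powr (r - 2) * w\<^sup>2 + \<bar>w\<bar> powr r)"
  shows "expectation (\<lambda>\<omega>. \<bar>U \<omega> + W \<omega>\<bar> powr r) \<le> expectation (\<lambda>\<omega>. \<bar>U \<omega>\<bar> powr r)
    + C * (expectation (\<lambda>\<omega>. \<bar>U \<omega>\<bar> powr (r - 2)) * expectation (\<lambda>\<omega>. (W \<omega>)\<^sup>2)
           + expectation (\<lambda>\<omega>. \<bar>W \<omega>\<bar> powr r))"
proof -
  have [measurable]: "U \<in> borel_measurable M" "W \<in> borel_measurable M"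
    using ind by (auto dest: indep_var_rv1 indep_var_rv2)
  have iW: "integrable M W" "integrable M (\<lambda>\<omega>. (W \<omega>)\<^sup>2)"
    using W r integrable_of_abs_powr[of W r] integrable_power2_of_abs_powr[of W r] by auto
  have U1: "integrable M (\<lambda>\<omega>. sgn (U \<omega>) * \<bar>U \<omega>\<bar> powr (r - 1))"
  proof (rule Bochner_Integration.integrable_bound)
    show "integrable M (\<lambda>\<omega>. \<bar>U \<omega>\<bar> powr (r - 1))"
      using integrable_abs_powr_mono[OF U] r by auto
  qed (auto simp: abs_mult sgn_if)
  have U2: "integrable M (\<lambda>\<omega>. \<bar>U \<omega>\<bar> powr (r - 2))"
    using integrable_abs_powr_mono[OF U] r by auto
  have quad: "integrable M (\<lambda>\<omega>. \<bar>U \<omega>\<bar> powr (r - 2) * (W \<omega>)\<^sup>2)"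
       "expectation (\<lambda>\<omega>. \<bar>U \<omega>\<bar> powr (r - 2) * (W \<omega>)\<^sup>2)
         = expectation (\<lambda>\<omega>. \<bar>U \<omega>\<bar> powr (r - 2)) * expectation (\<lambda>\<omega>. (W \<omega>)\<^sup>2)"
    by (rule indep_var_expectation_mult[OF ind, of "\<lambda>x. \<bar>x\<bar> powr (r - 2)" "\<lambda>w. w\<^sup>2", OF _ _ U2 iW(2)]; measurable)+
  have lin: "integrable M (\<lambda>\<omega>. (sgn (U \<omega>) * \<bar>U \<omega>\<bar> powr (r - 1)) * W \<omega>)"
       "expectation (\<lambda>\<omega>. (sgn (U \<omega>) * \<bar>U \<omega>\<bar> powr (r - 1)) * W \<omega>) = 0"
    subgoal by (rule indep_var_expectation_mult[OF ind, of "\<lambda>x. sgn x * \<bar>x\<bar> powr (r - 1)" "\<lambda>w. w", OF _ _ U1 iW(1)]; measurable)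
    subgoal by (subst indep_var_expectation_mult[OF ind, of "\<lambda>x. sgn x * \<bar>x\<bar> powr (r - 1)" "\<lambda>w. w", OF _ _ U1 iW(1)])
      (use W0 in simp_all)
    done
  have "expectation (\<lambda>\<omega>. \<bar>U \<omega> + W \<omega>\<bar> powr r) \<le> expectation (\<lambda>\<omega>. \<bar>U \<omega>\<bar> powr r
       + r * ((sgn (U \<omega>) * \<bar>U \<omega>\<bar> powr (r - 1)) * W \<omega>)
       + C * (\<bar>U \<omega>\<bar> powr (r - 2) * (W \<omega>)\<^sup>2 + \<bar>W \<omega>\<bar> powr r))"
  proof (rule integral_mono)
    show "integrable M (\<lambda>\<omega>. \<bar>U \<omega> + W \<omega>\<bar> powr r)"
      using U W r by (intro integrable_abs_add_powr) auto
  qed (intro Bochner_Integration.integrable_add integrable_mult_right U W lin quad C)+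
  also have "\<dots> = expectation (\<lambda>\<omega>. \<bar>U \<omega>\<bar> powr r)
       + r * expectation (\<lambda>\<omega>. (sgn (U \<omega>) * \<bar>U \<omega>\<bar> powr (r - 1)) * W \<omega>)
       + C * (expectation (\<lambda>\<omega>. \<bar>U \<omega>\<bar> powr (r - 2) * (W \<omega>)\<^sup>2) + expectation (\<lambda>\<omega>. \<bar>W \<omega>\<bar> powr r))"
    using U W lin(1) quad(1) by simp
  also have "\<dots> = expectation (\<lambda>\<omega>. \<bar>U \<omega>\<bar> powr r)
    + C * (expectation (\<lambda>\<omega>. \<bar>U \<omega>\<bar> powr (r - 2)) * expectation (\<lambda>\<omega>. (W \<omega>)\<^sup>2)
           + expectation (\<lambda>\<omega>. \<bar>W \<omega>\<bar> powr r))"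
    unfolding lin(2) quad(2) by simp
  finally show ?thesis .
qed

text \<open>Variances of independent variables add up, since the cross terms vanish. This exact
  value, as opposed to an upper bound, yields the leading coefficient of the variance.\<close>

lemma expectation_sum_power2:
  fixes W :: "nat \<Rightarrow> 'a \<Rightarrow> real"
  assumes "indep_vars (\<lambda>_. borel) W {1..n}"
    and "\<And>j. j \<in> {1..n} \<Longrightarrow> integrable M (\<lambda>\<omega>. (W j \<omega>)\<^sup>2)"
    and "\<And>j. j \<in> {1..n} \<Longrightarrow> expectation (W j) = 0"
  shows "integrable M (\<lambda>\<omega>. (\<Sum>j=1..n. W j \<omega>)\<^sup>2) \<and>
    expectation (\<lambda>\<omega>. (\<Sum>j=1..n. W j \<omega>)\<^sup>2) = (\<Sum>j=1..n. expectation (\<lambda>\<omega>. (W j \<omega>)\<^sup>2))"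
  using assms
proof (induction n)
  case (Suc n)
  have rv[measurable]: "W j \<in> borel_measurable M" if "j \<in> {1..Suc n}" for j
    using indep_vars_rv[OF Suc.prems(1) that] .
  have iW: "integrable M (W j)" if "j \<in> {1..Suc n}" for j
    using rv[OF that] Suc.prems(2)[OF that] by (rule square_integrable_imp_integrable)
  let ?S = "\<lambda>\<omega>. \<Sum>j=1..n. W j \<omega>"
  have iS: "integrable M ?S" using iW by (intro Bochner_Integration.integrable_sum) auto
  have IH: "integrable M (\<lambda>\<omega>. (?S \<omega>)\<^sup>2)"
    "expectation (\<lambda>\<omega>. (?S \<omega>)\<^sup>2) = (\<Sum>j=1..n. expectation (\<lambda>\<omega>. (W j \<omega>)\<^sup>2))"
    using Suc.IH[OF indep_vars_subset[OF Suc.prems(1)]] Suc.prems(2,3) by auto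
  have ind: "indep_var borel (W (Suc n)) borel ?S"
    using Suc.prems(1) by (intro indep_vars_sum) (auto simp: atLeastAtMostSuc_conv)
  note mixed = indep_var_integrable[OF ind iW iS] indep_var_lebesgue_integral[OF ind iW iS]
  have eq: "(\<lambda>\<omega>. (\<Sum>j=1..Suc n. W j \<omega>)\<^sup>2) = (\<lambda>\<omega>. (?S \<omega>)\<^sup>2 + 2 * (W (Suc n) \<omega> * ?S \<omega>) + (W (Suc n) \<omega>)\<^sup>2)"
    by (auto simp: power2_sum)
  show ?case
    unfolding eq using IH Suc.prems(2)[of "Suc n"] Suc.prems(3)[of "Suc n"] mixed by simp
qed simp

end

section \<open>Absolute moments of sums of centered independent variables\<close>

text \<open>A splitting at \<open>x^2 = c\<close> that replaces an interpolation between moments: a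
  large \<open>c\<close> makes the coefficient of the \<open>r\<close>-th power small at the cost of
  a larger constant term.\<close>

lemma powr_diff_two_le:
  fixes x c r :: real
  assumes "c > 0" "r \<ge> 2"
  shows "\<bar>x\<bar> powr (r - 2) \<le> \<bar>x\<bar> powr r / c + c powr (r / 2 - 1)"
proof (cases "x\<^sup>2 \<le> c")
  case True
  have "\<bar>x\<bar> powr (r - 2) = (\<bar>x\<bar> powr 2) powr (r / 2 - 1)"
    by (simp only: powr_powr) (simp add: algebra_simps)
  also have "\<dots> \<le> c powr (r / 2 - 1)"
    using True assms by (intro powr_mono2) auto
  finally show ?thesis using assms by (simp add: add_increasing)
next
  case False
  have "c * \<bar>x\<bar> powr (r - 2) \<le> \<bar>x\<bar> powr 2 * \<bar>x\<bar> powr (r - 2)"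
    using False by (intro mult_right_mono) auto
  also have "\<dots> = \<bar>x\<bar> powr r" by (subst powr_add[symmetric]) simp
  finally have "\<bar>x\<bar> powr (r - 2) \<le> \<bar>x\<bar> powr r / c" using assms by (simp add: field_simps)
  then show ?thesis using powr_ge_zero[of c "r / 2 - 1"] by linarith
qed

text \<open>Induction on \<open>n\<close>: adding one variable raises the moment by at most a
  constant times \<open>n powr (r / 2 - 1)\<close>, which is the growth rate of
  \<open>n powr (r / 2)\<close>. The constant depends on \<open>r\<close> and \<open>B\<close> only,
  and so serves all probability spaces at once.\<close>

lemma expectation_abs_sum_powr_le:
  fixes r B :: real
  assumes r: "r > 2" and B: "B \<ge> 0"
  obtains K where "K \<ge> 0"
    and "\<And>(M :: 'a measure) W n. \<lbrakk>prob_space M; prob_space.indep_vars M (\<lambda>_. borel) W {1..n};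
      \<And>j. j \<in> {1..n} \<Longrightarrow> integrable M (\<lambda>\<omega>. \<bar>W j \<omega>\<bar> powr r);
      \<And>j. j \<in> {1..n} \<Longrightarrow> (\<integral>\<omega>. \<bar>W j \<omega>\<bar> powr r \<partial>M) \<le> B;
      \<And>j. j \<in> {1..n} \<Longrightarrow> (\<integral>\<omega>. W j \<omega> \<partial>M) = 0\<rbrakk> \<Longrightarrow>
      integrable M (\<lambda>\<omega>. \<bar>\<Sum>j=1..n. W j \<omega>\<bar> powr r) \<and>
      (\<integral>\<omega>. \<bar>\<Sum>j=1..n. W j \<omega>\<bar> powr r \<partial>M) \<le> K * real n powr (r / 2)"
proof -
  obtain C where C1: "C \<ge> 1"
    and C: "\<And>x w. \<bar>x + w\<bar> powr r \<le> \<bar>x\<bar> powr r + r * ((sgn x * \<bar>x\<bar> powr (r - 1)) * w)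
            + C * (\<bar>x\<bar> powr (r - 2) * w\<^sup>2 + \<bar>w\<bar> powr r)"
    using abs_add_powr_le[of r] r by auto
  \<comment> \<open>A bound for the second moments of the summands, from
    \<open>w^2 <= 1 + |w| powr r\<close>.\<close>
  define v where "v = 1 + B"
  \<comment> \<open>The term \<open>C * v * E\<bar>S\<bar>\<^sup>r / (A * n)\<close> of the induction step is half of the growth of
    \<open>K * n powr (r / 2)\<close>.\<close>
  define A where "A = 2 * C * v"
  \<comment> \<open>Half of \<open>K\<close> pays for those terms of the increment that do not
    contain the moment of the partial sum.\<close>
  define K where "K = 2 * (C * v * A powr (r / 2 - 1) + C * B)"
  have v: "v > 0" using B by (simp add: v_def)
  have A: "A > 0" using v C1 by (simp add: A_def)
  have CB: "B \<le> C * B" "0 \<le> C * B" using B C1 mult_right_mono[of 1 C B] by auto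
  have "B \<le> 2 * (C * B)" using CB by linarith
  also have "\<dots> \<le> K" using C1 v unfolding K_def by (intro mult_left_mono) simp_all
  finally have KB: "K \<ge> B" .
  then have K: "K \<ge> 0" using B by linarith
  show thesis
  proof (rule that[OF K], goal_cases)
    case (1 M W n)
    interpret prob_space M by fact
    show ?case using 1(2-5)
    proof (induction n)
      case (Suc n)
      let ?S = "\<lambda>\<omega>. \<Sum>j=1..n. W j \<omega>" and ?W = "W (Suc n)"
      have rv[measurable]: "W j \<in> borel_measurable M" if "j \<in> {1..Suc n}" for j
        using indep_vars_rv[OF Suc.prems(1) that] .
      have [measurable]: "?S \<in> borel_measurable M" "?W \<in> borel_measurable M" by auto
      have IH: "integrable M (\<lambda>\<omega>. \<bar>?S \<omega>\<bar> powr r)"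
        "expectation (\<lambda>\<omega>. \<bar>?S \<omega>\<bar> powr r) \<le> K * real n powr (r / 2)"
        using Suc.IH[OF indep_vars_subset[OF Suc.prems(1)]] Suc.prems(2-4) by auto
      have W: "integrable M (\<lambda>\<omega>. \<bar>?W \<omega>\<bar> powr r)" "expectation (\<lambda>\<omega>. \<bar>?W \<omega>\<bar> powr r) \<le> B"
        "expectation ?W = 0"
        using Suc.prems(2-4) by auto
      have "integrable M (\<lambda>\<omega>. (?W \<omega>)\<^sup>2)"
        using W r by (intro integrable_power2_of_abs_powr[where r = r]) auto
      then have "expectation (\<lambda>\<omega>. (?W \<omega>)\<^sup>2) \<le> expectation (\<lambda>\<omega>. 1 + \<bar>?W \<omega>\<bar> powr r)"
        using W r powr_le_one_plus_powr[of "\<bar>?W _\<bar>" 2 r] by (intro integral_mono) auto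
      also have "\<dots> \<le> v" using W by (simp add: v_def prob_space)
      finally have W2: "expectation (\<lambda>\<omega>. (?W \<omega>)\<^sup>2) \<le> v" .
      have int: "integrable M (\<lambda>\<omega>. \<bar>?S \<omega> + ?W \<omega>\<bar> powr r)"
        using IH W r by (intro integrable_abs_add_powr) auto
      have ind: "indep_var borel ?W borel ?S"
        using Suc.prems(1) by (intro indep_vars_sum) (auto simp: atLeastAtMostSuc_conv)
      have "expectation (\<lambda>\<omega>. \<bar>?S \<omega> + ?W \<omega>\<bar> powr r) \<le> K * real (Suc n) powr (r / 2)"
      \<comment> \<open>The splitting level \<open>A * n\<close> has to be positive; a single
        summand is covered by \<open>B <= K\<close>.\<close>
      proof (cases "n = 0")
        case True
        then show ?thesis using W KB by simp
      next
        case False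
        then have n: "real n > 0" by simp
        let ?m = "expectation (\<lambda>\<omega>. \<bar>?S \<omega>\<bar> powr r)" and ?k = "real n powr (r / 2 - 1)"
        have pow: "real n powr (r / 2) = real n * ?k"
          using n by (simp add: powr_diff)
        have k1: "?k \<ge> 1" using n r False by (intro ge_one_powr_ge_zero) auto
        \<comment> \<open>The level \<open>A * n\<close> matches the typical size
          \<open>sqrt n\<close> of the partial sum, so both parts of the bound are of order
          \<open>?k\<close>.\<close>
        have "expectation (\<lambda>\<omega>. \<bar>?S \<omega>\<bar> powr (r - 2))
            \<le> expectation (\<lambda>\<omega>. \<bar>?S \<omega>\<bar> powr r / (A * n) + (A * n) powr (r / 2 - 1))"
          using IH r A n powr_diff_two_le[of "A * n" r "?S _"]
          by (intro integral_mono integrable_abs_powr_mono[OF IH(1)]) auto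
        also have "\<dots> = ?m / (A * n) + (A * n) powr (r / 2 - 1)"
          using IH by (simp add: prob_space)
        also have "\<dots> \<le> (K * (real n * ?k)) / (A * n) + A powr (r / 2 - 1) * ?k"
          using IH(2) A n by (intro add_mono divide_right_mono) (auto simp: pow powr_mult)
        also have "\<dots> = (K / A + A powr (r / 2 - 1)) * ?k" using n A by (simp add: field_simps)
        finally have S2: "expectation (\<lambda>\<omega>. \<bar>?S \<omega>\<bar> powr (r - 2)) \<le> (K / A + A powr (r / 2 - 1)) * ?k" .
        have "expectation (\<lambda>\<omega>. \<bar>?S \<omega> + ?W \<omega>\<bar> powr r) \<le> ?m
          + C * (expectation (\<lambda>\<omega>. \<bar>?S \<omega>\<bar> powr (r - 2)) * expectation (\<lambda>\<omega>. (?W \<omega>)\<^sup>2)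
           + expectation (\<lambda>\<omega>. \<bar>?W \<omega>\<bar> powr r))"
          using expectation_abs_add_powr_le[OF ind IH(1) W(1) W(3) _ C] r by simp
        also have "\<dots> \<le> K * (real n * ?k) + C * (((K / A + A powr (r / 2 - 1)) * ?k) * v + B * ?k)"
        proof (intro add_mono mult_left_mono mult_mono)
          show "expectation (\<lambda>\<omega>. \<bar>?W \<omega>\<bar> powr r) \<le> B * ?k"
            using W(2) mult_left_mono[OF k1 B] by simp
        qed (use IH(2) S2 W2 C1 K A in \<open>auto simp: pow\<close>)
        also have "\<dots> = K * (real n * ?k) + (C * v * (K / A) + K / 2) * ?k"
          by (simp add: K_def algebra_simps)
        also have "C * v * (K / A) = K / 2" using A v C1 by (simp add: A_def)
        also have "K * (real n * ?k) + (K / 2 + K / 2) * ?k = K * (real (Suc n) * ?k)"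
          by (simp add: algebra_simps)
        \<comment> \<open>Raising \<open>n\<close> to \<open>Suc n\<close> inside \<open>?k\<close>
          completes the power \<open>r / 2\<close> of \<open>Suc n\<close>.\<close>
        also have "\<dots> \<le> K * (real (Suc n) * real (Suc n) powr (r / 2 - 1))"
          using K r by (intro mult_left_mono powr_mono2) auto
        also have "\<dots> = K * real (Suc n) powr (r / 2)" by (simp add: powr_diff)
        finally show ?thesis .
      qed
      with int show ?case by simp
    qed simp
  qed
qed

section \<open>Mean and variance of a power of the normalized sum\<close>

text \<open>The pointwise expansions are integrated against the moment bounds for the centered sum.
  \<open>K\<close> is chosen before the space, the variables and \<open>n\<close>, because the
  intended application uses a different space in every dimension.\<close>

lemma normalized_sum_powr_moments:
  fixes a r \<mu> v B :: real
  assumes a: "a > 0" and r: "r \<ge> 2 * a" "r \<ge> a" "r \<ge> 3" and \<mu>: "\<mu> > 0" and B: "B \<ge> 0"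
  obtains K where "K \<ge> 0"
    and "\<And>(M :: 'a measure) Z n. \<lbrakk>prob_space M; n \<ge> 1; prob_space.indep_vars M (\<lambda>_. borel) Z {1..n};
      \<And>j \<omega>. 0 \<le> Z j \<omega>;
      \<And>j. j \<in> {1..n} \<Longrightarrow> integrable M (\<lambda>\<omega>. \<bar>Z j \<omega> - \<mu>\<bar> powr r);
      \<And>j. j \<in> {1..n} \<Longrightarrow> (\<integral>\<omega>. \<bar>Z j \<omega> - \<mu>\<bar> powr r \<partial>M) \<le> B;
      \<And>j. j \<in> {1..n} \<Longrightarrow> (\<integral>\<omega>. Z j \<omega> \<partial>M) = \<mu>;
      \<And>j. j \<in> {1..n} \<Longrightarrow> (\<integral>\<omega>. (Z j \<omega> - \<mu>)\<^sup>2 \<partial>M) = v\<rbrakk> \<Longrightarrow>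
      integrable M (\<lambda>\<omega>. ((\<Sum>j=1..n. Z j \<omega>) / (n * \<mu>)) powr a) \<and>
      integrable M (\<lambda>\<omega>. (((\<Sum>j=1..n. Z j \<omega>) / (n * \<mu>)) powr a)\<^sup>2) \<and>
      \<bar>(\<integral>\<omega>. ((\<Sum>j=1..n. Z j \<omega>) / (n * \<mu>)) powr a \<partial>M) - 1\<bar> \<le> K / n \<and>
      \<bar>prob_space.variance M (\<lambda>\<omega>. ((\<Sum>j=1..n. Z j \<omega>) / (n * \<mu>)) powr a) - a\<^sup>2 * v / (\<mu>\<^sup>2 * n)\<bar>
        \<le> K * real n powr (-3/2)"
proof -
  obtain C1 where C1: "C1 \<ge> 1" "\<And>t. \<bar>\<bar>1 + t\<bar> powr a - 1 - a * t\<bar> \<le> C1 * (t\<^sup>2 + \<bar>t\<bar> powr r)"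
    using abs_one_plus_powr_first_order[of a r] a r by auto
  obtain C2 where C2: "C2 \<ge> 1"
    "\<And>t. \<bar>(\<bar>1 + t\<bar> powr a - 1)\<^sup>2 - a\<^sup>2 * t\<^sup>2\<bar> \<le> C2 * (\<bar>t\<bar> powr 3 + \<bar>t\<bar> powr r)"
    using abs_one_plus_powr_second_order[of a r] a r by auto
  have r2: "r > 2" using r by simp
  obtain Kr where Kr: "Kr \<ge> 0" "\<And>(M :: 'a measure) W n. \<lbrakk>prob_space M; prob_space.indep_vars M (\<lambda>_. borel) W {1..n};
      \<And>j. j \<in> {1..n} \<Longrightarrow> integrable M (\<lambda>\<omega>. \<bar>W j \<omega>\<bar> powr r);
      \<And>j. j \<in> {1..n} \<Longrightarrow> (\<integral>\<omega>. \<bar>W j \<omega>\<bar> powr r \<partial>M) \<le> B;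
      \<And>j. j \<in> {1..n} \<Longrightarrow> (\<integral>\<omega>. W j \<omega> \<partial>M) = 0\<rbrakk> \<Longrightarrow>
      integrable M (\<lambda>\<omega>. \<bar>\<Sum>j=1..n. W j \<omega>\<bar> powr r) \<and>
      (\<integral>\<omega>. \<bar>\<Sum>j=1..n. W j \<omega>\<bar> powr r \<partial>M) \<le> Kr * real n powr (r / 2)"
    by (rule expectation_abs_sum_powr_le[OF r2 B]) blast
  \<comment> \<open>The second-order error contains a third power besides the \<open>r\<close>-th;
    the third moments of the summands are at most \<open>1 + B\<close> because
    \<open>r >= 3\<close>.\<close>
  obtain K3 where K3: "K3 \<ge> 0" "\<And>(M :: 'a measure) W n. \<lbrakk>prob_space M; prob_space.indep_vars M (\<lambda>_. borel) W {1..n};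
      \<And>j. j \<in> {1..n} \<Longrightarrow> integrable M (\<lambda>\<omega>. \<bar>W j \<omega>\<bar> powr 3);
      \<And>j. j \<in> {1..n} \<Longrightarrow> (\<integral>\<omega>. \<bar>W j \<omega>\<bar> powr 3 \<partial>M) \<le> 1 + B;
      \<And>j. j \<in> {1..n} \<Longrightarrow> (\<integral>\<omega>. W j \<omega> \<partial>M) = 0\<rbrakk> \<Longrightarrow>
      integrable M (\<lambda>\<omega>. \<bar>\<Sum>j=1..n. W j \<omega>\<bar> powr 3) \<and>
      (\<integral>\<omega>. \<bar>\<Sum>j=1..n. W j \<omega>\<bar> powr 3 \<partial>M) \<le> K3 * real n powr (3 / 2)"
    by (rule expectation_abs_sum_powr_le[of 3 "1 + B"]) (use B in \<open>simp, simp, blast\<close>)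
  define L1 where "L1 = C1 * (\<bar>v\<bar> / \<mu>\<^sup>2 + Kr / \<mu> powr r)"
  define L2 where "L2 = C2 * (K3 / \<mu> powr 3 + Kr / \<mu> powr r)"
  have L: "L1 \<ge> 0" "L2 \<ge> 0" using C1 C2 Kr K3 by (simp_all add: L1_def L2_def)
  show thesis
  \<comment> \<open>\<open>L1\<close> is the constant for the mean; the variance needs
    \<open>L2\<close> for the second moment about 1 and \<open>L1^2\<close> for the squared
    bias.\<close>
  proof (rule that[of "L1 + L2 + L1\<^sup>2"], goal_cases)
    case (2 M Z n)
    interpret prob_space M by fact
    define W where "W = (\<lambda>j \<omega>. Z j \<omega> - \<mu>)"
    define T where "T = (\<lambda>\<omega>. \<Sum>j=1..n. W j \<omega>)"
    define t where "t = (\<lambda>\<omega>. T \<omega> / (n * \<mu>))"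
    define h where "h = (\<lambda>\<omega>. \<bar>1 + t \<omega>\<bar> powr a)"
    have n: "real n > 0" "real n \<ge> 1" using 2 by auto
    have T: "T \<omega> = (\<Sum>j=1..n. Z j \<omega>) - n * \<mu>" for \<omega>
      by (simp add: T_def W_def sum_subtractf)
    have t1: "1 + t \<omega> = (\<Sum>j=1..n. Z j \<omega>) / (n * \<mu>)" for \<omega>
      using n \<mu> by (simp add: t_def T field_simps)
    \<comment> \<open>The absolute value in \<open>h\<close> changes nothing, as the
      \<open>Z j\<close> are nonnegative; it only matches the pointwise lemmas.\<close>
    have h: "((\<Sum>j=1..n. Z j \<omega>) / (n * \<mu>)) powr a = h \<omega>" for \<omega>
    proof -
      have "(\<Sum>j=1..n. Z j \<omega>) / (n * \<mu>) \<ge> 0"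
        using n \<mu> 2(4) by (intro divide_nonneg_pos sum_nonneg) auto
      then show ?thesis unfolding h_def t1 by (simp only: abs_of_nonneg)
    qed
    have rvZ: "Z j \<in> borel_measurable M" if "j \<in> {1..n}" for j
      using indep_vars_rv[OF 2(3) that] .
    have rvW[measurable]: "W j \<in> borel_measurable M" if "j \<in> {1..n}" for j
      using rvZ[OF that] unfolding W_def by measurable
    have T_meas[measurable]: "T \<in> borel_measurable M"
      unfolding T_def by (intro borel_measurable_sum rvW)
    have t_meas[measurable]: "t \<in> borel_measurable M" unfolding t_def by measurable
    have h_meas[measurable]: "h \<in> borel_measurable M" unfolding h_def by measurable
    have indW: "indep_vars (\<lambda>_. borel) W {1..n}"
      unfolding W_def by (rule indep_vars_compose2[OF 2(3)]) measurable
    have Wr: "integrable M (\<lambda>\<omega>. \<bar>W j \<omega>\<bar> powr r)" "expectation (\<lambda>\<omega>. \<bar>W j \<omega>\<bar> powr r) \<le> B"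
      if "j \<in> {1..n}" for j
      using 2(5,6)[OF that] by (simp_all add: W_def)
    have W2: "integrable M (\<lambda>\<omega>. (W j \<omega>)\<^sup>2)" if "j \<in> {1..n}" for j
      using integrable_power2_of_abs_powr[OF Wr(1)[OF that] rvW[OF that]] r by simp
    have W1: "integrable M (W j)" if "j \<in> {1..n}" for j
      using integrable_of_abs_powr[OF Wr(1)[OF that] rvW[OF that]] r by simp
    have W0: "expectation (W j) = 0" if "j \<in> {1..n}" for j
    proof -
      have "integrable M (\<lambda>\<omega>. W j \<omega> + \<mu>)" using W1[OF that] by simp
      then have "integrable M (Z j)" by (simp add: W_def)
      then show ?thesis using 2(7)[OF that] by (simp add: W_def prob_space)
    qed
    have W3: "integrable M (\<lambda>\<omega>. \<bar>W j \<omega>\<bar> powr 3)" "expectation (\<lambda>\<omega>. \<bar>W j \<omega>\<bar> powr 3) \<le> 1 + B"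
      if j: "j \<in> {1..n}" for j
    proof -
      show int: "integrable M (\<lambda>\<omega>. \<bar>W j \<omega>\<bar> powr 3)"
        using r by (intro integrable_abs_powr_mono[OF Wr(1)[OF j] rvW[OF j]]) auto
      have "expectation (\<lambda>\<omega>. \<bar>W j \<omega>\<bar> powr 3) \<le> expectation (\<lambda>\<omega>. 1 + \<bar>W j \<omega>\<bar> powr r)"
        using int Wr(1)[OF j] r by (intro integral_mono powr_le_one_plus_powr) auto
      also have "\<dots> \<le> 1 + B" using Wr[OF j] by (simp add: prob_space)
      finally show "expectation (\<lambda>\<omega>. \<bar>W j \<omega>\<bar> powr 3) \<le> 1 + B" .
    qed
    have Tr: "integrable M (\<lambda>\<omega>. \<bar>T \<omega>\<bar> powr r)"
        "expectation (\<lambda>\<omega>. \<bar>T \<omega>\<bar> powr r) \<le> Kr * real n powr (r / 2)"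
      using Kr(2)[OF prob_space_axioms indW Wr W0] by (auto simp: T_def)
    have T3: "integrable M (\<lambda>\<omega>. \<bar>T \<omega>\<bar> powr 3)"
        "expectation (\<lambda>\<omega>. \<bar>T \<omega>\<bar> powr 3) \<le> K3 * real n powr (3 / 2)"
      using K3(2)[OF prob_space_axioms indW W3 W0] by (auto simp: T_def)
    have T2: "integrable M (\<lambda>\<omega>. (T \<omega>)\<^sup>2)" "expectation (\<lambda>\<omega>. (T \<omega>)\<^sup>2) = n * v"
      using expectation_sum_power2[OF indW W2 W0] 2(8) by (auto simp: T_def W_def)
    have T1: "integrable M T" "expectation T = 0"
      using W1 W0 by (auto simp: T_def)
    have t_powr: "\<bar>t \<omega>\<bar> powr s = \<bar>T \<omega>\<bar> powr s / (n * \<mu>) powr s" for \<omega> s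
      using n \<mu> by (simp add: t_def powr_divide)
    have tr: "integrable M (\<lambda>\<omega>. \<bar>t \<omega>\<bar> powr r)"
      "expectation (\<lambda>\<omega>. \<bar>t \<omega>\<bar> powr r) \<le> Kr / \<mu> powr r * real n powr (-3/2)"
    proof -
      show "integrable M (\<lambda>\<omega>. \<bar>t \<omega>\<bar> powr r)" using Tr by (simp add: t_powr)
      have "expectation (\<lambda>\<omega>. \<bar>t \<omega>\<bar> powr r) \<le> (Kr * real n powr (r / 2)) / (n * \<mu>) powr r"
        using Tr(2) by (simp add: t_powr divide_right_mono)
      also have "\<dots> = Kr / \<mu> powr r * (real n powr (r / 2) / real n powr r)" by (simp add: powr_mult)
      also have "\<dots> = Kr / \<mu> powr r * real n powr (- r / 2)" by (simp add: powr_diff[symmetric])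
      \<comment> \<open>Here \<open>r >= 3\<close> enters: the \<open>r\<close>-th moment of
        \<open>t\<close> decays at least as fast as the third.\<close>
      also have "\<dots> \<le> Kr / \<mu> powr r * real n powr (-3/2)"
        using n r Kr by (intro mult_left_mono powr_mono) auto
      finally show "expectation (\<lambda>\<omega>. \<bar>t \<omega>\<bar> powr r) \<le> Kr / \<mu> powr r * real n powr (-3/2)" .
    qed
    have t3: "integrable M (\<lambda>\<omega>. \<bar>t \<omega>\<bar> powr 3)"
      "expectation (\<lambda>\<omega>. \<bar>t \<omega>\<bar> powr 3) \<le> K3 / \<mu> powr 3 * real n powr (-3/2)"
    proof -
      show "integrable M (\<lambda>\<omega>. \<bar>t \<omega>\<bar> powr 3)" unfolding t_powr by (intro integrable_divide_zero T3)
      have "expectation (\<lambda>\<omega>. \<bar>t \<omega>\<bar> powr 3) = expectation (\<lambda>\<omega>. \<bar>T \<omega>\<bar> powr 3) / (n * \<mu>) powr 3"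
        unfolding t_powr by (rule integral_divide_zero)
      also have "\<dots> \<le> (K3 * real n powr (3 / 2)) / (n * \<mu>) powr 3"
        using T3(2) by (rule divide_right_mono) (rule powr_ge_zero)
      also have "\<dots> = K3 / \<mu> powr 3 * (real n powr (3 / 2) / real n powr 3)" unfolding powr_mult by simp
      also have "\<dots> = K3 / \<mu> powr 3 * real n powr (-3/2)" unfolding powr_diff[symmetric] by simp
      finally show "expectation (\<lambda>\<omega>. \<bar>t \<omega>\<bar> powr 3) \<le> K3 / \<mu> powr 3 * real n powr (-3/2)" .
    qed
    have t2: "integrable M (\<lambda>\<omega>. (t \<omega>)\<^sup>2)" "expectation (\<lambda>\<omega>. (t \<omega>)\<^sup>2) = v / \<mu>\<^sup>2 / n"
      using T2 n \<mu> by (simp_all add: t_def power_divide power_mult_distrib) (simp add: power2_eq_square)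
    have t1: "integrable M t" "expectation t = 0"
      using T1 by (auto simp: t_def)
    \<comment> \<open>Integrability of \<open>h\<close> is obtained from that of its expansion
      error, which has an integrable bound.\<close>
    have ih: "integrable M (\<lambda>\<omega>. h \<omega> - 1 - a * t \<omega>)"
    proof (rule Bochner_Integration.integrable_bound)
      show "integrable M (\<lambda>\<omega>. C1 * ((t \<omega>)\<^sup>2 + \<bar>t \<omega>\<bar> powr r))" using t2 tr by simp
      show "AE \<omega> in M. norm (h \<omega> - 1 - a * t \<omega>) \<le> norm (C1 * ((t \<omega>)\<^sup>2 + \<bar>t \<omega>\<bar> powr r))"
        using C1(1) order_trans[OF C1(2) abs_ge_self] by (intro AE_I2) (simp add: h_def)
    qed measurable
    have "integrable M (\<lambda>\<omega>. (h \<omega> - 1 - a * t \<omega>) + (1 + a * t \<omega>))"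
      using ih t1 by (intro Bochner_Integration.integrable_add) auto
    then have int_h: "integrable M h" by simp
    have ih2: "integrable M (\<lambda>\<omega>. (h \<omega> - 1)\<^sup>2 - a\<^sup>2 * (t \<omega>)\<^sup>2)"
    proof (rule Bochner_Integration.integrable_bound)
      show "integrable M (\<lambda>\<omega>. C2 * (\<bar>t \<omega>\<bar> powr 3 + \<bar>t \<omega>\<bar> powr r))"
        by (intro integrable_mult_right Bochner_Integration.integrable_add t3 tr)
      show "AE \<omega> in M. norm ((h \<omega> - 1)\<^sup>2 - a\<^sup>2 * (t \<omega>)\<^sup>2) \<le> norm (C2 * (\<bar>t \<omega>\<bar> powr 3 + \<bar>t \<omega>\<bar> powr r))"
        unfolding h_def real_norm_def by (intro AE_I2 order_trans[OF C2(2) abs_ge_self])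
    qed measurable
    have "integrable M (\<lambda>\<omega>. ((h \<omega> - 1)\<^sup>2 - a\<^sup>2 * (t \<omega>)\<^sup>2) + a\<^sup>2 * (t \<omega>)\<^sup>2)"
      using ih2 t2 by (intro Bochner_Integration.integrable_add) auto
    then have int_hm2: "integrable M (\<lambda>\<omega>. (h \<omega> - 1)\<^sup>2)" by simp
    have "integrable M (\<lambda>\<omega>. (h \<omega> - 1)\<^sup>2 + (2 * h \<omega> - 1))"
      using int_hm2 int_h by (intro Bochner_Integration.integrable_add) auto
    then have int_h2: "integrable M (\<lambda>\<omega>. (h \<omega>)\<^sup>2)" by (simp add: power2_eq_square algebra_simps)
    have mean: "\<bar>expectation h - 1\<bar> \<le> L1 / n"
    proof -
      have "expectation h - 1 = expectation (\<lambda>\<omega>. h \<omega> - 1 - a * t \<omega>)"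
        using int_h t1 by (simp add: prob_space)
      also have "\<bar>\<dots>\<bar> \<le> expectation (\<lambda>\<omega>. \<bar>h \<omega> - 1 - a * t \<omega>\<bar>)"
        by (rule integral_abs_bound)
      also have "\<dots> \<le> expectation (\<lambda>\<omega>. C1 * ((t \<omega>)\<^sup>2 + \<bar>t \<omega>\<bar> powr r))"
        using ih t2 tr C1(2) by (intro integral_mono) (auto simp: h_def)
      also have "\<dots> = C1 * (v / \<mu>\<^sup>2 / n + expectation (\<lambda>\<omega>. \<bar>t \<omega>\<bar> powr r))"
        using t2 tr by simp
      also have "\<dots> \<le> C1 * (\<bar>v\<bar> / \<mu>\<^sup>2 / n + Kr / \<mu> powr r / n)"
      proof (intro mult_left_mono add_mono)
        have "real n powr (-3/2) \<le> real n powr (-1)" using n by (intro powr_mono) auto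
        then have "real n powr (-3/2) \<le> 1 / n" using n by (simp add: powr_minus_divide)
        then have "Kr / \<mu> powr r * real n powr (-3/2) \<le> Kr / \<mu> powr r * (1 / n)"
          using Kr by (intro mult_left_mono) auto
        then show "expectation (\<lambda>\<omega>. \<bar>t \<omega>\<bar> powr r) \<le> Kr / \<mu> powr r / n"
          using tr(2) by simp
      qed (use C1 n in \<open>auto intro!: divide_right_mono\<close>)
      also have "\<dots> = L1 / n" by (simp add: L1_def add_divide_distrib distrib_left)
      finally show ?thesis .
    qed
    have second: "\<bar>expectation (\<lambda>\<omega>. (h \<omega> - 1)\<^sup>2) - a\<^sup>2 * v / (\<mu>\<^sup>2 * n)\<bar> \<le> L2 * real n powr (-3/2)"
    proof -
      have "expectation (\<lambda>\<omega>. (h \<omega> - 1)\<^sup>2) - a\<^sup>2 * v / (\<mu>\<^sup>2 * n)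
          = expectation (\<lambda>\<omega>. (h \<omega> - 1)\<^sup>2 - a\<^sup>2 * (t \<omega>)\<^sup>2)"
        using int_hm2 t2 by simp
      also have "\<bar>\<dots>\<bar> \<le> expectation (\<lambda>\<omega>. \<bar>(h \<omega> - 1)\<^sup>2 - a\<^sup>2 * (t \<omega>)\<^sup>2\<bar>)"
        by (rule integral_abs_bound)
      also have "\<dots> \<le> expectation (\<lambda>\<omega>. C2 * (\<bar>t \<omega>\<bar> powr 3 + \<bar>t \<omega>\<bar> powr r))"
      proof (rule integral_mono)
        show "\<bar>(h \<omega> - 1)\<^sup>2 - a\<^sup>2 * (t \<omega>)\<^sup>2\<bar> \<le> C2 * (\<bar>t \<omega>\<bar> powr 3 + \<bar>t \<omega>\<bar> powr r)" for \<omega>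
          unfolding h_def by (rule C2(2))
      qed (intro integrable_abs ih2 integrable_mult_right Bochner_Integration.integrable_add t3 tr)+
      also have "\<dots> = C2 * (expectation (\<lambda>\<omega>. \<bar>t \<omega>\<bar> powr 3) + expectation (\<lambda>\<omega>. \<bar>t \<omega>\<bar> powr r))"
        using Bochner_Integration.integral_add[OF t3(1) tr(1)] by simp
      also have "\<dots> \<le> C2 * (K3 / \<mu> powr 3 * real n powr (-3/2) + Kr / \<mu> powr r * real n powr (-3/2))"
        using C1 C2(1) by (intro mult_left_mono add_mono t3 tr) auto
      also have "\<dots> = L2 * real n powr (-3/2)" unfolding L2_def by (simp only: distrib_right mult.assoc)
      finally show ?thesis .
    qed
    \<comment> \<open>The second moment is taken about 1, the limit of the mean, so the correction
      is the square of an \<open>O(1 / n)\<close> term and hence negligible.\<close>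
    have var: "variance h = expectation (\<lambda>\<omega>. (h \<omega> - 1)\<^sup>2) - (expectation h - 1)\<^sup>2"
    proof -
      have "variance h = variance (\<lambda>\<omega>. h \<omega> - 1)" using int_h by (simp add: prob_space)
      also have "\<dots> = expectation (\<lambda>\<omega>. (h \<omega> - 1)\<^sup>2) - (expectation (\<lambda>\<omega>. h \<omega> - 1))\<^sup>2"
        using int_h int_hm2 by (intro variance_eq) auto
      also have "expectation (\<lambda>\<omega>. h \<omega> - 1) = expectation h - 1" using int_h by (simp add: prob_space)
      finally show ?thesis .
    qed
    have "(expectation h - 1)\<^sup>2 \<le> L1\<^sup>2 * real n powr (-3/2)"
    proof -
      have "(expectation h - 1)\<^sup>2 \<le> (L1 / n)\<^sup>2"
        using mean L n by (intro abs_le_square_iff[THEN iffD1]) auto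
      also have "\<dots> = L1\<^sup>2 * real n powr (-2)"
        using n by (simp add: power_divide powr_minus_divide)
      also have "\<dots> \<le> L1\<^sup>2 * real n powr (-3/2)" using n by (intro mult_left_mono powr_mono) auto
      finally show ?thesis .
    qed
    then have "\<bar>variance h - a\<^sup>2 * v / (\<mu>\<^sup>2 * n)\<bar> \<le> L2 * real n powr (-3/2) + L1\<^sup>2 * real n powr (-3/2)"
      using second zero_le_power2[of "expectation h - 1"] unfolding var by linarith
    also have "\<dots> \<le> (L1 + L2 + L1\<^sup>2) * real n powr (-3/2)"
      using L by (simp add: distrib_right)
    finally have var': "\<bar>variance h - a\<^sup>2 * v / (\<mu>\<^sup>2 * n)\<bar> \<le> (L1 + L2 + L1\<^sup>2) * real n powr (-3/2)" .
    have "L1 / n \<le> (L1 + L2 + L1\<^sup>2) / n" using L n by (intro divide_right_mono) auto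
    then have mean': "\<bar>expectation h - 1\<bar> \<le> (L1 + L2 + L1\<^sup>2) / n" using mean by linarith
    show ?case unfolding h using int_h int_h2 mean' var' by blast
  qed (use L in simp)
qed

section \<open>From i.i.d. copies to the norm\<close>

text \<open>Both integrals are integrals of \<open>f\<close> against the common law of
  \<open>Y j\<close> and \<open>X\<close>, although the two variables live on different
  spaces.\<close>

lemma integral_iid_copy:
  fixes f :: "real \<Rightarrow> real"
  assumes "prob_space N" "iid_copies N Y d M X" "j \<in> {1..d}" "X \<in> borel_measurable M"
    and [measurable]: "f \<in> borel_measurable borel"
  shows "integrable N (\<lambda>\<omega>. f (Y j \<omega>)) \<longleftrightarrow> integrable M (\<lambda>\<omega>. f (X \<omega>))"
    and "(\<integral>\<omega>. f (Y j \<omega>) \<partial>N) = (\<integral>\<omega>. f (X \<omega>) \<partial>M)"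
proof -
  interpret prob_space N by fact
  have eq: "distr N borel (Y j) = distr M borel X" and Y: "Y j \<in> borel_measurable N"
    using assms(2,3) indep_vars_rv[of "\<lambda>_. borel" Y "{1..d}" j] by (auto simp: iid_copies_def)
  show "integrable N (\<lambda>\<omega>. f (Y j \<omega>)) \<longleftrightarrow> integrable M (\<lambda>\<omega>. f (X \<omega>))"
    using integrable_distr_eq[OF Y assms(5)] integrable_distr_eq[OF assms(4,5)] eq by simp
  show "(\<integral>\<omega>. f (Y j \<omega>) \<partial>N) = (\<integral>\<omega>. f (X \<omega>) \<partial>M)"
    using integral_distr[OF Y assms(5)] integral_distr[OF assms(4,5)] eq by simp
qed

text \<open>If one absolute moment vanishes, then \<open>X = 0\<close> almost everywhere and every
  other one vanishes too. This carries positivity from the moment of order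
  \<open>max 4 (3 * p)\<close> over to \<mu>, by which the sum is divided.\<close>

lemma (in prob_space) abs_moment_pos:
  assumes [measurable]: "X \<in> borel_measurable M"
    and "integrable M (\<lambda>\<omega>. \<bar>X \<omega>\<bar> powr p)" and "0 < abs_moment M X s"
  shows "0 < abs_moment M X p"
proof (rule ccontr)
  assume "\<not> 0 < abs_moment M X p"
  then have "expectation (\<lambda>\<omega>. \<bar>X \<omega>\<bar> powr p) = 0"
    by (auto simp: abs_moment_def intro!: antisym integral_nonneg)
  then have "AE \<omega> in M. \<bar>X \<omega>\<bar> powr p = 0"
    using assms(2) by (subst (asm) integral_nonneg_eq_0_iff_AE) auto
  then have "AE \<omega> in M. \<bar>X \<omega>\<bar> powr s = 0" by eventually_elim simp
  then have "abs_moment M X s = 0" unfolding abs_moment_def by (rule integral_eq_zero_AE)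
  with assms(3) show False by simp
qed

lemma lp_norm_normalized:
  assumes "c > 0"
  shows "lp_norm p d x = c powr (1 / p) * ((\<Sum>j=1..d. \<bar>x j\<bar> powr p) / c) powr (1 / p)"
  using assms unfolding lp_norm_def powr_mult[symmetric] by simp

text \<open>The bridge from probability to asymptotics: \<open>e d\<close> and \<open>w d\<close>
  are the mean and variance of the norm divided by \<open>(d * \<mu>) powr (1 / p)\<close>, and
  everything about them that the limits require is in the two error bounds, with one
  \<open>K\<close> for all dimensions.\<close>

lemma lp_norm_moments:
  fixes p :: real
    and M :: "'a measure" and X :: "'a \<Rightarrow> real"
    and N :: "nat \<Rightarrow> 'b measure" and Y :: "nat \<Rightarrow> nat \<Rightarrow> 'b \<Rightarrow> real"
  assumes p: "p > 0"
    and M: "prob_space M" and X: "X \<in> borel_measurable M"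
    and int: "integrable M (\<lambda>\<omega>. \<bar>X \<omega>\<bar> powr max 4 (3 * p))"
    and pos: "0 < abs_moment M X (max 4 (3 * p))"
    and N: "\<And>d. d \<ge> 1 \<Longrightarrow> prob_space (N d)"
    and iid: "\<And>d. d \<ge> 1 \<Longrightarrow> iid_copies (N d) (Y d) d M X"
  defines "\<mu> \<equiv> abs_moment M X p"
  obtains K e w where "K \<ge> 0"
    and "\<And>d. d \<ge> 1 \<Longrightarrow> integrable (N d) (\<lambda>\<omega>. lp_norm p d (\<lambda>j. Y d j \<omega>))"
    and "\<And>d. d \<ge> 1 \<Longrightarrow> integrable (N d) (\<lambda>\<omega>. (lp_norm p d (\<lambda>j. Y d j \<omega>))\<^sup>2)"
    and "\<And>d. d \<ge> 1 \<Longrightarrow> prob_space.expectation (N d) (\<lambda>\<omega>. lp_norm p d (\<lambda>j. Y d j \<omega>))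
      = (d * \<mu>) powr (1 / p) * e d"
    and "\<And>d. d \<ge> 1 \<Longrightarrow> prob_space.variance (N d) (\<lambda>\<omega>. lp_norm p d (\<lambda>j. Y d j \<omega>))
      = (d * \<mu>) powr (2 / p) * w d"
    and "\<And>d. d \<ge> 1 \<Longrightarrow> \<bar>e d - 1\<bar> \<le> K / real d"
    and "\<And>d. d \<ge> 1 \<Longrightarrow> \<bar>w d - (abs_pow_sd M X p / (p * \<mu>))\<^sup>2 / real d\<bar> \<le> K * real d powr (-3/2)"
proof -
  interpret M: prob_space M by fact
  define m where "m = max 4 (3 * p)"
  define r where "r = m / p"
  define v where "v = M.variance (\<lambda>\<omega>. \<bar>X \<omega>\<bar> powr p)"
  define B where "B = M.expectation (\<lambda>\<omega>. \<bar>\<bar>X \<omega>\<bar> powr p - \<mu>\<bar> powr r)"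
  define S where "S = (\<lambda>d \<omega>. \<Sum>j=1..d. \<bar>Y d j \<omega>\<bar> powr p)"
  define h where "h = (\<lambda>d \<omega>. (S d \<omega> / (d * \<mu>)) powr (1 / p))"
  have "integrable M (\<lambda>\<omega>. \<bar>X \<omega>\<bar> powr p)"
    using M.integrable_abs_powr_mono[OF int X, of p] p by (simp add: max_def)
  then have \<mu>: "\<mu> > 0" unfolding \<mu>_def using M.abs_moment_pos[OF X _ pos] by blast
  \<comment> \<open>The entry \<open>3 * p\<close> of the maximum gives \<open>r >= 3\<close>, and
    the entry 4 gives \<open>r >= 4 / p\<close>, more than the \<open>2 / p\<close> asked
    for.\<close>
  have "m \<ge> 4" "m \<ge> 3 * p" by (simp_all add: m_def)
  then have r: "r \<ge> 2 * (1 / p)" "r \<ge> 1 / p" "r \<ge> 3"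
    using p by (simp_all add: r_def field_simps)
  have "B \<ge> 0" unfolding B_def by (intro Bochner_Integration.integral_nonneg) simp
  obtain K where "K \<ge> 0" and K: "\<And>(M :: 'b measure) Z n. \<lbrakk>prob_space M; n \<ge> 1; prob_space.indep_vars M (\<lambda>_. borel) Z {1..n};
      \<And>j \<omega>. 0 \<le> Z j \<omega>;
      \<And>j. j \<in> {1..n} \<Longrightarrow> integrable M (\<lambda>\<omega>. \<bar>Z j \<omega> - \<mu>\<bar> powr r);
      \<And>j. j \<in> {1..n} \<Longrightarrow> (\<integral>\<omega>. \<bar>Z j \<omega> - \<mu>\<bar> powr r \<partial>M) \<le> B;
      \<And>j. j \<in> {1..n} \<Longrightarrow> (\<integral>\<omega>. Z j \<omega> \<partial>M) = \<mu>;
      \<And>j. j \<in> {1..n} \<Longrightarrow> (\<integral>\<omega>. (Z j \<omega> - \<mu>)\<^sup>2 \<partial>M) = v\<rbrakk> \<Longrightarrow>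
      integrable M (\<lambda>\<omega>. ((\<Sum>j=1..n. Z j \<omega>) / (n * \<mu>)) powr (1 / p)) \<and>
      integrable M (\<lambda>\<omega>. (((\<Sum>j=1..n. Z j \<omega>) / (n * \<mu>)) powr (1 / p))\<^sup>2) \<and>
      \<bar>(\<integral>\<omega>. ((\<Sum>j=1..n. Z j \<omega>) / (n * \<mu>)) powr (1 / p) \<partial>M) - 1\<bar> \<le> K / n \<and>
      \<bar>prob_space.variance M (\<lambda>\<omega>. ((\<Sum>j=1..n. Z j \<omega>) / (n * \<mu>)) powr (1 / p)) - (1 / p)\<^sup>2 * v / (\<mu>\<^sup>2 * n)\<bar>
        \<le> K * real n powr (-3/2)"
    by (rule normalized_sum_powr_moments[OF _ r \<mu> \<open>B \<ge> 0\<close>, of v]) (use p in \<open>simp, blast\<close>)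
  have XB: "integrable M (\<lambda>\<omega>. \<bar>\<bar>X \<omega>\<bar> powr p - \<mu>\<bar> powr r)"
  proof -
    have "integrable M (\<lambda>\<omega>. \<bar>\<bar>X \<omega>\<bar> powr p + - \<mu>\<bar> powr r)"
    proof (rule M.integrable_abs_add_powr)
      \<comment> \<open>As \<open>p * r = m\<close>, this is exactly the assumed moment of
        \<open>X\<close>.\<close>
      show "integrable M (\<lambda>\<omega>. \<bar>\<bar>X \<omega>\<bar> powr p\<bar> powr r)"
        using int p by (simp add: r_def m_def powr_powr)
    qed (use r X in \<open>simp_all add: \<mu>\<close>)
    then show ?thesis by simp
  qed
  have core: "integrable (N d) (h d) \<and> integrable (N d) (\<lambda>\<omega>. (h d \<omega>)\<^sup>2) \<and>
      \<bar>(\<integral>\<omega>. h d \<omega> \<partial>N d) - 1\<bar> \<le> K / d \<and>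
      \<bar>prob_space.variance (N d) (h d) - (1 / p)\<^sup>2 * v / (\<mu>\<^sup>2 * d)\<bar> \<le> K * real d powr (-3/2)"
    if d: "d \<ge> 1" for d
    unfolding h_def S_def
  proof (rule K[OF N[OF d] d])
    interpret prob_space "N d" using N[OF d] .
    note Y = integral_iid_copy[OF N[OF d] iid[OF d] _ X]
    have "indep_vars (\<lambda>_. borel) (Y d) {1..d}" using iid[OF d] by (simp add: iid_copies_def)
    then show "indep_vars (\<lambda>_. borel) (\<lambda>j \<omega>. \<bar>Y d j \<omega>\<bar> powr p) {1..d}"
      by (rule indep_vars_compose2) measurable
    fix j assume j: "j \<in> {1..d}"
    show "integrable (N d) (\<lambda>\<omega>. \<bar>\<bar>Y d j \<omega>\<bar> powr p - \<mu>\<bar> powr r)"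
      by (subst Y(1)[OF j, of "\<lambda>y. \<bar>\<bar>y\<bar> powr p - \<mu>\<bar> powr r"]) (measurable, rule XB)
    show "expectation (\<lambda>\<omega>. \<bar>\<bar>Y d j \<omega>\<bar> powr p - \<mu>\<bar> powr r) \<le> B"
      by (subst Y(2)[OF j, of "\<lambda>y. \<bar>\<bar>y\<bar> powr p - \<mu>\<bar> powr r"]) (measurable, simp add: B_def)
    show "expectation (\<lambda>\<omega>. \<bar>Y d j \<omega>\<bar> powr p) = \<mu>"
      by (subst Y(2)[OF j, of "\<lambda>y. \<bar>y\<bar> powr p"]) (measurable, simp add: \<mu>_def abs_moment_def)
    show "expectation (\<lambda>\<omega>. (\<bar>Y d j \<omega>\<bar> powr p - \<mu>)\<^sup>2) = v"
      by (subst Y(2)[OF j, of "\<lambda>y. (\<bar>y\<bar> powr p - \<mu>)\<^sup>2"])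
        (measurable, simp add: v_def \<mu>_def abs_moment_def)
  qed simp
  have lp: "lp_norm p d (\<lambda>j. Y d j \<omega>) = (d * \<mu>) powr (1 / p) * h d \<omega>" if "d \<ge> 1" for d \<omega>
    unfolding h_def S_def using that \<mu> by (intro lp_norm_normalized) simp
  have sd: "(abs_pow_sd M X p / (p * \<mu>))\<^sup>2 / real d = (1 / p)\<^sup>2 * v / (\<mu>\<^sup>2 * d)" for d :: nat
  proof -
    have "(abs_pow_sd M X p)\<^sup>2 = v" unfolding abs_pow_sd_def v_def
      by (rule real_sqrt_pow2[OF M.variance_positive])
    then show ?thesis by (simp add: power_divide power_mult_distrib)
  qed
  show thesis
  proof (rule that[OF \<open>K \<ge> 0\<close>, of "\<lambda>d. \<integral>\<omega>. h d \<omega> \<partial>N d" "\<lambda>d. prob_space.variance (N d) (h d)"])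
    fix d :: nat assume d: "d \<ge> 1"
    interpret prob_space "N d" using N[OF d] .
    let ?c = "(d * \<mu>) powr (1 / p)"
    note core = core[OF d]
    have c: "?c\<^sup>2 = (d * \<mu>) powr (2 / p)"
      by (simp add: power2_eq_square powr_add[symmetric])
    show "integrable (N d) (\<lambda>\<omega>. lp_norm p d (\<lambda>j. Y d j \<omega>))"
      using core by (simp add: lp[OF d])
    show "integrable (N d) (\<lambda>\<omega>. (lp_norm p d (\<lambda>j. Y d j \<omega>))\<^sup>2)"
      using core by (simp add: lp[OF d] power_mult_distrib)
    show "expectation (\<lambda>\<omega>. lp_norm p d (\<lambda>j. Y d j \<omega>)) = ?c * expectation (h d)"
      by (simp add: lp[OF d])
    show "variance (\<lambda>\<omega>. lp_norm p d (\<lambda>j. Y d j \<omega>)) = (d * \<mu>) powr (2 / p) * variance (h d)"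
      by (simp add: lp[OF d] c[symmetric] right_diff_distrib[symmetric] power_mult_distrib)
    show "\<bar>expectation (h d) - 1\<bar> \<le> K / d" using core by blast
    show "\<bar>variance (h d) - (abs_pow_sd M X p / (p * \<mu>))\<^sup>2 / real d\<bar> \<le> K * real d powr (-3/2)"
      unfolding sd using core by blast
  qed
qed

section \<open>Asymptotics as the dimension grows\<close>

theorem proposition3:
  fixes p :: real
    and M :: "'a measure" and X :: "'a \<Rightarrow> real"
    and N :: "nat \<Rightarrow> 'b measure" and Y :: "nat \<Rightarrow> nat \<Rightarrow> 'b \<Rightarrow> real"
  assumes "p > 0"
    and "prob_space M" and "X \<in> borel_measurable M"
    and "integrable M (\<lambda>\<omega>. \<bar>X \<omega>\<bar> powr max 4 (3 * p))"
    and "0 < abs_moment M X (max 4 (3 * p))"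
    and "\<And>d. d \<ge> 1 \<Longrightarrow> prob_space (N d)"
    and "\<And>d. d \<ge> 1 \<Longrightarrow> iid_copies (N d) (Y d) d M X"
  shows "(\<forall>d\<ge>1. integrable (N d) (\<lambda>\<omega>. lp_norm p d (\<lambda>j. Y d j \<omega>)) \<and>
                 integrable (N d) (\<lambda>\<omega>. (lp_norm p d (\<lambda>j. Y d j \<omega>))\<^sup>2)) \<and>
    (\<lambda>d. prob_space.expectation (N d) (\<lambda>\<omega>. lp_norm p d (\<lambda>j. Y d j \<omega>))
           - real d powr (1 / p) * abs_moment M X p powr (1 / p))
      \<in> O(\<lambda>d. real d powr (1 / p - 1)) \<and>
    (\<lambda>d. prob_space.variance (N d) (\<lambda>\<omega>. lp_norm p d (\<lambda>j. Y d j \<omega>))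
           - abs_moment M X p powr (2 / p - 2) * (abs_pow_sd M X p)\<^sup>2
               / (real d powr (1 - 2 / p) * p\<^sup>2))
      \<in> o(\<lambda>d. real d powr (- 1 + 2 / p)) \<and>
    (\<lambda>d. sqrt (real d * prob_space.variance (N d) (\<lambda>\<omega>. lp_norm p d (\<lambda>j. Y d j \<omega>)))
           / prob_space.expectation (N d) (\<lambda>\<omega>. lp_norm p d (\<lambda>j. Y d j \<omega>)))
      \<longlonglongrightarrow> abs_pow_sd M X p / (p * abs_moment M X p)"
proof -
  define \<mu> where "\<mu> = abs_moment M X p"
  define \<sigma> where "\<sigma> = abs_pow_sd M X p"
  define E where "E = (\<lambda>d. prob_space.expectation (N d) (\<lambda>\<omega>. lp_norm p d (\<lambda>j. Y d j \<omega>)))"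
  define V where "V = (\<lambda>d. prob_space.variance (N d) (\<lambda>\<omega>. lp_norm p d (\<lambda>j. Y d j \<omega>)))"
  interpret M: prob_space M by fact
  obtain K e w where "K \<ge> 0"
    and int: "\<And>d. d \<ge> 1 \<Longrightarrow> integrable (N d) (\<lambda>\<omega>. lp_norm p d (\<lambda>j. Y d j \<omega>))"
      "\<And>d. d \<ge> 1 \<Longrightarrow> integrable (N d) (\<lambda>\<omega>. (lp_norm p d (\<lambda>j. Y d j \<omega>))\<^sup>2)"
    and E: "\<And>d. d \<ge> 1 \<Longrightarrow> E d = (d * \<mu>) powr (1 / p) * e d"
    and V: "\<And>d. d \<ge> 1 \<Longrightarrow> V d = (d * \<mu>) powr (2 / p) * w d"
    and e: "\<And>d. d \<ge> 1 \<Longrightarrow> \<bar>e d - 1\<bar> \<le> K / real d"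
    and w: "\<And>d. d \<ge> 1 \<Longrightarrow> \<bar>w d - (\<sigma> / (p * \<mu>))\<^sup>2 / real d\<bar> \<le> K * real d powr (-3/2)"
    unfolding E_def V_def \<mu>_def \<sigma>_def by (rule lp_norm_moments[OF assms]) blast+
  have p: "p > 0" by fact
  have "integrable M (\<lambda>\<omega>. \<bar>X \<omega>\<bar> powr p)"
    using M.integrable_abs_powr_mono[OF assms(4,3), of p] p by (simp add: max_def)
  then have \<mu>: "\<mu> > 0" unfolding \<mu>_def using M.abs_moment_pos[OF assms(3) _ assms(5)] by blast
  have "\<sigma> \<ge> 0" unfolding \<sigma>_def abs_pow_sd_def by (intro real_sqrt_ge_zero M.variance_positive)
  have mean: "(\<lambda>d. E d - real d powr (1 / p) * \<mu> powr (1 / p)) \<in> O(\<lambda>d. real d powr (1 / p - 1))"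
  proof (rule bigoI)
    show "\<forall>\<^sub>F d in sequentially. norm (E d - real d powr (1 / p) * \<mu> powr (1 / p))
        \<le> (\<mu> powr (1 / p) * K) * norm (real d powr (1 / p - 1))"
      using eventually_ge_at_top[of 1]
    proof eventually_elim
      case (elim d)
      have "E d - real d powr (1 / p) * \<mu> powr (1 / p) = (d * \<mu>) powr (1 / p) * (e d - 1)"
        using E[OF elim] by (simp add: powr_mult algebra_simps)
      then have "norm (E d - real d powr (1 / p) * \<mu> powr (1 / p)) = (d * \<mu>) powr (1 / p) * \<bar>e d - 1\<bar>"
        by (simp add: abs_mult)
      also have "\<dots> \<le> (d * \<mu>) powr (1 / p) * (K / d)"
        using e[OF elim] by (intro mult_left_mono) auto
      also have "\<dots> = (\<mu> powr (1 / p) * K) * norm (real d powr (1 / p - 1))"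
        using elim by (simp add: powr_mult powr_diff)
      finally show ?case .
    qed
  qed
  \<comment> \<open>The leading term is put into the normalized form of \<open>V d\<close>, so that
    the error factors as a power of \<open>d * \<mu>\<close> times the error of
    \<open>w d\<close>.\<close>
  have main_term: "\<mu> powr (2 / p - 2) * \<sigma>\<^sup>2 / (real d powr (1 - 2 / p) * p\<^sup>2)
      = (d * \<mu>) powr (2 / p) * ((\<sigma> / (p * \<mu>))\<^sup>2 / real d)" if "d \<ge> 1" for d
  proof -
    have "\<mu> powr (2 / p - 2) = \<mu> powr (2 / p) / \<mu>\<^sup>2" using \<mu> by (subst powr_diff) simp
    moreover have "real d powr (1 - 2 / p) = real d / real d powr (2 / p)"
      using that by (subst powr_diff) simp
    ultimately show ?thesis by (simp add: powr_mult power_divide power_mult_distrib mult_ac)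
  qed
  \<comment> \<open>The rate proved here beats the required little-o by a factor
    \<open>sqrt d\<close>.\<close>
  have "(\<lambda>d. V d - \<mu> powr (2 / p - 2) * \<sigma>\<^sup>2 / (real d powr (1 - 2 / p) * p\<^sup>2))
      \<in> O(\<lambda>d. real d powr (2 / p - 3 / 2))"
  proof (rule bigoI)
    show "\<forall>\<^sub>F d in sequentially. norm (V d - \<mu> powr (2 / p - 2) * \<sigma>\<^sup>2 / (real d powr (1 - 2 / p) * p\<^sup>2))
        \<le> (\<mu> powr (2 / p) * K) * norm (real d powr (2 / p - 3 / 2))"
      using eventually_ge_at_top[of 1]
    proof eventually_elim
      case (elim d)
      have "V d - \<mu> powr (2 / p - 2) * \<sigma>\<^sup>2 / (real d powr (1 - 2 / p) * p\<^sup>2)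
          = (d * \<mu>) powr (2 / p) * (w d - (\<sigma> / (p * \<mu>))\<^sup>2 / real d)"
        unfolding main_term[OF elim] V[OF elim] by (rule right_diff_distrib[symmetric])
      then have "norm (V d - \<mu> powr (2 / p - 2) * \<sigma>\<^sup>2 / (real d powr (1 - 2 / p) * p\<^sup>2))
          = (d * \<mu>) powr (2 / p) * \<bar>w d - (\<sigma> / (p * \<mu>))\<^sup>2 / real d\<bar>"
        by (simp add: abs_mult)
      also have "\<dots> \<le> (d * \<mu>) powr (2 / p) * (K * real d powr (-3/2))"
        using w[OF elim] by (intro mult_left_mono) auto
      also have "\<dots> = (\<mu> powr (2 / p) * K) * (real d powr (2 / p) * real d powr (-3/2))"
        by (simp add: powr_mult)
      also have "\<dots> = (\<mu> powr (2 / p) * K) * norm (real d powr (2 / p - 3 / 2))"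
        by (simp add: powr_add[symmetric])
      finally show ?case .
    qed
  qed
  moreover have "(\<lambda>d. real d powr (2 / p - 3 / 2)) \<in> o(\<lambda>d. real d powr (- 1 + 2 / p))"
    using p by real_asymp
  ultimately have var: "(\<lambda>d. V d - \<mu> powr (2 / p - 2) * \<sigma>\<^sup>2 / (real d powr (1 - 2 / p) * p\<^sup>2))
      \<in> o(\<lambda>d. real d powr (- 1 + 2 / p))"
    by (rule landau_o.big_small_trans)
  \<comment> \<open>The power of \<open>d * \<mu>\<close> cancels in the quotient, leaving
    \<open>sqrt (d * w d) / e d\<close>; its limit follows directly from the bounds on
    \<open>w\<close> and \<open>e\<close>.\<close>
  have ratio: "(\<lambda>d. sqrt (real d * V d) / E d) \<longlonglongrightarrow> \<sigma> / (p * \<mu>)"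
  proof -
    have "(\<lambda>d. e d - 1) \<longlonglongrightarrow> 0"
    proof (rule Lim_null_comparison)
      show "\<forall>\<^sub>F d in sequentially. norm (e d - 1) \<le> K / real d"
        using eventually_ge_at_top[of 1] by eventually_elim (use e in simp)
    qed (rule lim_const_over_n)
    then have e1: "e \<longlonglongrightarrow> 1" by (simp add: LIM_zero_iff)
    have "(\<lambda>d. real d * w d - (\<sigma> / (p * \<mu>))\<^sup>2) \<longlonglongrightarrow> 0"
    proof (rule Lim_null_comparison)
      show "\<forall>\<^sub>F d in sequentially. norm (real d * w d - (\<sigma> / (p * \<mu>))\<^sup>2) \<le> K * real d powr (-1/2)"
        using eventually_ge_at_top[of 1]
      proof eventually_elim
        case (elim d)
        have "real d * w d - (\<sigma> / (p * \<mu>))\<^sup>2 = real d * (w d - (\<sigma> / (p * \<mu>))\<^sup>2 / real d)"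
          using elim by (simp add: right_diff_distrib)
        then have "norm (real d * w d - (\<sigma> / (p * \<mu>))\<^sup>2) = real d * \<bar>w d - (\<sigma> / (p * \<mu>))\<^sup>2 / real d\<bar>"
          by (simp add: abs_mult)
        also have "\<dots> \<le> real d * (K * real d powr (-3/2))"
          using w[OF elim] by (intro mult_left_mono) auto
        also have "\<dots> = K * (real d powr 1 * real d powr (-3/2))" using elim by simp
        also have "\<dots> = K * real d powr (-1/2)" by (subst powr_add[symmetric]) simp
        finally show ?case .
      qed
      have "(\<lambda>d. real d powr (-1/2)) \<longlonglongrightarrow> 0"
        by (rule tendsto_neg_powr[OF _ filterlim_real_sequentially]) simp
      then show "(\<lambda>d. K * real d powr (-1/2)) \<longlonglongrightarrow> 0" by (rule tendsto_mult_right_zero)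
    qed
    then have "(\<lambda>d. real d * w d) \<longlonglongrightarrow> (\<sigma> / (p * \<mu>))\<^sup>2" by (simp add: LIM_zero_iff)
    then have "(\<lambda>d. sqrt (real d * w d) / e d) \<longlonglongrightarrow> sqrt ((\<sigma> / (p * \<mu>))\<^sup>2) / 1"
      using e1 by (intro tendsto_divide tendsto_real_sqrt) auto
    \<comment> \<open>The root of the square is the quotient itself, and not its negative, because
      \<sigma> is nonnegative.\<close>
    also have "sqrt ((\<sigma> / (p * \<mu>))\<^sup>2) / 1 = \<sigma> / (p * \<mu>)" using \<open>\<sigma> \<ge> 0\<close> p \<mu> by simp
    finally show ?thesis
    proof (rule Lim_transform_eventually)
      show "\<forall>\<^sub>F d in sequentially. sqrt (real d * w d) / e d = sqrt (real d * V d) / E d"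
        using eventually_ge_at_top[of 1]
      proof eventually_elim
        case (elim d)
        let ?c = "(d * \<mu>) powr (1 / p)"
        have "?c > 0" using elim \<mu> by simp
        have "real d * V d = ?c\<^sup>2 * (real d * w d)"
          unfolding V[OF elim] by (simp add: power2_eq_square powr_add[symmetric])
        then have "sqrt (real d * V d) = ?c * sqrt (real d * w d)"
          by (simp only: real_sqrt_mult[of "?c\<^sup>2"] real_sqrt_abs abs_of_nonneg powr_ge_zero)
        then show ?case using E[OF elim] \<open>?c > 0\<close> by simp
      qed
    qed
  qed
  show ?thesis
    using int mean var ratio unfolding E_def V_def \<mu>_def \<sigma>_def by blast
qed

end
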